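(* Fix an integer $n\ge2$, $R_1>0$ and a threshold $\phi_s>0$. In the model described in the context, the bistatic sensing coverage probability $\mathcal P_{B_n}(R_1)=\mathbb P(\mathrm{SINR}_{B_n}>\phi_s)$ at the $n$-th nearest base station to a target that is at distance $R_1$ from the source base station is $$\mathcal P_{B_n}(R_1)=\int_{R_1}^\infty\!\int_0^\pi \frac{p_{LOS}(R_n)(M-1)}{M}\;\mathcal C_b(R_n,\beta)\;\mathcal L_{IC_b}\!\left(\frac{\phi_sR_1^{\eta_L}}{\sigma_{\mathrm{av}_t}\cos(\beta/2)};R_n,\beta\right)\exp\!\left(-\frac{\phi_s(4\pi)^3R_1^{\eta_L}R_n^{\eta_L}K_BTW_b}{P_sG_m^2\lambda^2\cos(\beta/2)\sigma_{\mathrm{av}_t}}\right)$$ $$\times\mathcal L_D\!\left(\frac{\phi_s(4\pi)^3R_1^{\eta_L}R_n^{\eta_L}}{P_sG_m^2\lambda^2\cos(\beta/2)\sigma_{\mathrm{av}_t}}\right)\frac{2(\lambda_{BS}\pi)^{n-1}}{(n-2)!}(R_n^2-R_1^2)^{n-2}R_ne^{-\lambda_{BS}\pi(R_n^2-R_1^2)}\cdot\frac1\pi\,d\beta\,dR_n,$$ where $$\mathcal C_b(R_n,\beta)=\exp\!\left(-\lambda_{cl}\frac{cR_n\theta_B}{2W_b\cos^2(\beta/2)}\cdot\frac{\phi_s\sigma_{\mathrm{av}_{cl}}}{\sigma_{\mathrm{av}_t}+\phi_s\sigma_{\mathrm{av}_{cl}}}\right),$$ $$\mathcal L_{IC_b}(s;R_n,\beta)=\int_{R_1}^\infty\!\int_0^\pi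 \exp\!\left(-\frac{2\pi\lambda_{BS}}{M}\int_{R_{IC}}^\infty p_{LOS}(r)\Big(1-\frac{1}{1+s\cos(\beta_I/2)r^{-\eta_L}\sigma_{\mathrm{av}_t}}\Big)r\,dr\right)$$ $$\times\exp\!\left(-\frac{\lambda_{BS}}{M}\int_{R_{IC}}^\infty p_{LOS}(r)\Big(1-\exp\Big(-\lambda_{cl}\frac{cR_n\theta_B}{2W_b\cos^2(\beta/2)}\frac{s\cos(\beta_I/2)r^{-\eta_L}\sigma_{\mathrm{av}_{cl}}}{1+s\cos(\beta_I/2)r^{-\eta_L}\sigma_{\mathrm{av}_{cl}}}\Big)\Big)2\pi r\,dr\right)2\lambda_{BS}R_{IC}e^{-\lambda_{BS}\pi(R_{IC}^2-R_1^2)}\,d\beta_I\,dR_{IC},$$ $$\mathcal L_D(s)=\int_0^\infty\exp\!\left(-\frac{2\pi\lambda_{BS}}{M^2}\int_{R_d}^\infty p_{LOS}(r)\Big(1-\Big(1+\frac{sP_cG_m^2C_Lr^{-\eta_L}}{m_L}\Big)^{-m_L}\Big)r\,dr\right)$$ $$\times\exp\!\left(-\frac{2\pi\lambda_{BS}}{M^2}\int_{R_d}^\infty (1-p_{LOS}(r))\Big(1-\Big(1+\frac{sP_cG_m^2C_Nr^{-\eta_N}}{m_N}\Big)^{-m_N}\Big)r\,dr\right)2\pi\lambda_{BS}R_de^{-\pi\lambda_{BS}R_d^2}\,dR_d .$$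
   Context: Parameters: $\lambda_{BS},\lambda_{cl},P_s,P_c,G_m,C_L,C_N,\eta_L,\eta_N,m_L,m_N,c,\theta_B,W_b,K_B,T,\lambda,\gamma,\sigma_{\mathrm{av}_t},\sigma_{\mathrm{av}_{cl}}>0$, $M$ a positive integer; $p_{LOS}(r)=e^{-\gamma r}$; convention $\exp(-\infty)=0$. PPP means Poisson point process. Geometry: given $R_1$, the distance $R_n$ from the target to its $n$-th nearest base station has density $\frac{2(\lambda_{BS}\pi)^{n-1}}{(n-2)!}(R_n^2-R_1^2)^{n-2}R_ne^{-\lambda_{BS}\pi(R_n^2-R_1^2)}$ on $[R_1,\infty)$, and the bistatic angle $\beta$ is independent of $R_n$ and uniform on $[0,\pi]$. All objects below are described conditionally on $(R_n,\beta)$. Reception indicator: $\mathbb 1_{c_1}$ is Bernoulli with success probability $p_{LOS}(R_n)\frac{M-1}{M}$ (the target is line-of-sight with the receiver, and the return arrives on a beam not using the same frequency). Target radar cross-section: $\sigma_{tm}$ is exponential with mean $\sigma_{\mathrm{av}_t}$; bistatic cross-section is $\sigma_{tm}\cos(\beta/2)$. Intra-clutter: scatterers form a homogeneous PPP $\Phi_{cl}$ on $\mathbb R^2$ of intensity $\lambda_{cl}$; $A_{rb}$ is a region (bistatic resolution cell) of area $\frac{cR_n\theta_B}{2W_b\cos^2(\beta/2)}$; each scatterer carries an independent exponential cross-section $\sigma_{cm}$ of mean $\sigma_{\mathrm{av}_{cl}}$; $S_b=\sum_{cl\in\Phi_{cl}\cap A_{rb}}\sigma_{cm}$; the bistatic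 clutter cross-section is $\sigma_{cm}\cos(\beta/2)$. Inter-clutter: $R_{IC}$ has density $2\pi\lambda_{BS}R_{IC}e^{-\lambda_{BS}\pi(R_{IC}^2-R_1^2)}$ on $[R_1,\infty)$ and $\beta_I$ is independent and uniform on $[0,\pi]$. Given $(R_{IC},\beta_I)$, the interfering base stations form a PPP on $\{x\in\mathbb R^2:|x|>R_{IC}\}$ of intensity $p_{LOS}(|x|)\lambda_{BS}/M$, and, with $R_v=|x|$ the distance of interferer $v$ from the target, $I_{IC1_b}=\sum_v\cos(\beta_I/2)R_v^{-\eta_L}\sigma_{tm,v}$ and $I_{IC2_b}=\sum_v\cos(\beta_I/2)R_v^{-\eta_L}S_{b,v}$, where the $\sigma_{tm,v}$ are i.i.d. copies of $\sigma_{tm}$ and the $S_{b,v}$ are i.i.d. copies of $S_b$. (The same $\beta_I$ is used for all interferers.) $I_{IC1_b}$ and $I_{IC2_b}$ are treated as independent given $(R_{IC},\beta_I)$. Direct interference: $R_d$ has density $2\pi\lambda_{BS}R_de^{-\pi\lambda_{BS}R_d^2}$ on $[0,\infty)$. Given $R_d$, $\Phi_{L_s}$ and $\Phi_{N_s}$ are independent PPPs on $\{|x|>R_d\}$ of intensities $p_{LOS}(|x|)\lambda_{BS}/M^2$ and $(1-p_{LOS}(|x|))\lambda_{BS}/M^2$; $I_{L_s}=\sum_{x_i\in\Phi_{L_s}}P_ch_{L,i}G_m^2C_L|x_i|^{-\eta_L}$, $I_{N_s}=\sum_{x_i\in\Phi_{N_s}}P_ch_{N,i}G_m^2C_N|x_i|^{-\eta_N}$,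 where the fading gains $h_{L,i}$ (resp. $h_{N,i}$) are i.i.d. Gamma with shape $m_L$ (resp. $m_N$) and mean $1$, independent of everything else. Independence: given $(R_n,\beta)$, the variables $\mathbb 1_{c_1}$, $\sigma_{tm}$, $S_b$, $(I_{IC1_b},I_{IC2_b})$ and $(I_{L_s},I_{N_s})$ are mutually independent. Bistatic SINR (with $\kappa=P_sG_m^2\lambda^2/(4\pi)^3$): $$\mathrm{SINR}_{B_n}=\frac{\mathbb 1_{c_1}\,\kappa\,\sigma_{tm}\cos(\beta/2)R_1^{-\eta_L}R_n^{-\eta_L}}{\kappa\cos(\beta/2)R_1^{-\eta_L}R_n^{-\eta_L}S_b+\kappa R_n^{-\eta_L}(I_{IC1_b}+I_{IC2_b})+K_BTW_b+I_{L_s}+I_{N_s}}.$$ *)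

theory Defs
  imports "HOL-Probability.Probability"
begin

section \<open>Conditioning and independence\<close>

definition generated_events :: "'w measure \<Rightarrow> 'a measure \<Rightarrow> ('w \<Rightarrow> 'a) \<Rightarrow> 'w set set" where
  "generated_events M N X = {X -` A \<inter> space M | A. A \<in> sets N}"

definition regular_conditional_probability ::
  "'w measure \<Rightarrow> 'a measure \<Rightarrow> ('w \<Rightarrow> 'a) \<Rightarrow> ('a \<Rightarrow> 'w measure) \<Rightarrow> bool" where
  "regular_conditional_probability M N X K \<longleftrightarrow>
     X \<in> measurable M N \<and> K \<in> measurable N (prob_algebra M) \<and>
     (\<forall>A\<in>sets M. \<forall>B\<in>sets N.
        emeasure M (X -` B \<inter> A) = (\<integral>\<^sup>+z\<in>B. emeasure (K z) A \<partial>distr M N X))"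

text \<open>
  "Given \<open>X = z\<close>, the statement \<open>Q z\<close> holds": the probability measure in force under the
  conditioning is a version of the regular conditional probability, and such conditional
  descriptions only make sense for almost every value \<open>z\<close>.
\<close>

definition conditionally_on ::
  "'w measure \<Rightarrow> 'a measure \<Rightarrow> ('w \<Rightarrow> 'a) \<Rightarrow> ('a \<Rightarrow> 'w measure \<Rightarrow> bool) \<Rightarrow> bool" where
  "conditionally_on M N X Q \<longleftrightarrow>
     (\<exists>K. regular_conditional_probability M N X K \<and> (AE z in distr M N X. Q z (K z)))"

definition iid_with_law :: "'w measure \<Rightarrow> 'a measure \<Rightarrow> (nat \<Rightarrow> 'w \<Rightarrow> 'a) \<Rightarrow> bool" where
  "iid_with_law M D H \<longleftrightarrow>
     prob_space.indep_vars M (\<lambda>_. D) H UNIV \<and> (\<forall>i. distr M D (H i) = D)"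

definition exponential_law :: "real \<Rightarrow> real measure" where
  "exponential_law \<mu> = density lborel (\<lambda>x. ennreal (exponential_density (1 / \<mu>) x))"

text \<open>Gamma distribution of shape \<open>m\<close> and mean 1, i.e. of rate \<open>m\<close>.\<close>

definition unit_mean_gamma_law :: "real \<Rightarrow> real measure" where
  "unit_mean_gamma_law m = density lborel (\<lambda>x. ennreal
     (if 0 < x then m powr m * x powr (m - 1) * exp (- m * x) / Gamma m else 0))"

section \<open>Planar Poisson point processes\<close>

text \<open>
  A configuration is an enumerated family of points: in \<open>(k, x)\<close> the points are \<open>x i\<close> for those
  \<open>i\<close> with \<open>enat i < k\<close>; the remaining values of \<open>x\<close> are meaningless. Marks of the points are
  attached through the same enumeration.
\<close>

type_synonym configuration = "enat \<times> (nat \<Rightarrow> real^2)"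

definition configurations :: "configuration measure" where
  "configurations = count_space UNIV \<Otimes>\<^sub>M PiM UNIV (\<lambda>_. borel)"

definition count_in :: "(real^2) set \<Rightarrow> configuration \<Rightarrow> ennreal" where
  "count_in A \<phi> = emeasure (count_space UNIV) {i. enat i < fst \<phi> \<and> snd \<phi> i \<in> A}"

definition sum_points :: "(nat \<Rightarrow> real^2 \<Rightarrow> ennreal) \<Rightarrow> configuration \<Rightarrow> ennreal" where
  "sum_points f \<phi> = (\<Sum>i. if enat i < fst \<phi> then f i (snd \<phi> i) else 0)"

definition poisson_point_process ::
  "'w measure \<Rightarrow> (real^2) measure \<Rightarrow> ('w \<Rightarrow> configuration) \<Rightarrow> bool" where
  "poisson_point_process M \<Lambda> \<Phi> \<longleftrightarrow>
     \<Phi> \<in> measurable M configurations \<and>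
     (\<forall>A\<in>sets borel. emeasure \<Lambda> A < \<infinity> \<longrightarrow>
        (\<forall>k. measure M {\<omega>\<in>space M. count_in A (\<Phi> \<omega>) = of_nat k} =
             measure \<Lambda> A ^ k / fact k * exp (- measure \<Lambda> A))) \<and>
     (\<forall>A :: nat \<Rightarrow> (real^2) set. range A \<subseteq> sets borel \<longrightarrow> disjoint_family A \<longrightarrow>
        prob_space.indep_vars M (\<lambda>_. borel) (\<lambda>i \<omega>. count_in (A i) (\<Phi> \<omega>)) UNIV)"

definition iid_marked_ppp ::
  "'w measure \<Rightarrow> (real^2) measure \<Rightarrow> 'a measure \<Rightarrow> ('w \<Rightarrow> configuration) \<Rightarrow>
   (nat \<Rightarrow> 'w \<Rightarrow> 'a) \<Rightarrow> bool" where
  "iid_marked_ppp M \<Lambda> D \<Phi> H \<longleftrightarrow>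
     poisson_point_process M \<Lambda> \<Phi> \<and> iid_with_law M D H \<and>
     prob_space.indep_sets M
       (case_option (generated_events M configurations \<Phi>) (\<lambda>i. generated_events M D (H i))) UNIV"

text \<open>Intensity measure with density \<open>g \<bar>x\<bar>\<close> on the exterior \<open>\<bar>x\<bar> > R\<close> of a disc.\<close>

definition exterior_intensity :: "real \<Rightarrow> (real \<Rightarrow> real) \<Rightarrow> (real^2) measure" where
  "exterior_intensity R g =
     density lborel (\<lambda>x. ennreal (g (norm x)) * indicator {x. R < norm x} x)"

section \<open>Parameters and random variables of the model\<close>

record radar =
  lam_BS :: real   lam_cl :: real
  P_s :: real      P_c :: real      G_m :: real
  C_L :: real      C_N :: real
  eta_L :: real    eta_N :: real
  m_L :: real      m_N :: real
  light_speed :: real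
  theta_B :: real  W_b :: real
  K_B :: real      temperature :: real
  wavelength :: real
  blockage :: real     \<comment> \<open>\<open>\<gamma>\<close>\<close>
  sig_t :: real    sig_cl :: real     \<comment> \<open>mean cross-sections of target and clutter scatterers\<close>
  n_freq :: nat        \<comment> \<open>\<open>M\<close>\<close>

definition valid_radar :: "radar \<Rightarrow> bool" where
  "valid_radar p \<longleftrightarrow>
     lam_BS p > 0 \<and> lam_cl p > 0 \<and> P_s p > 0 \<and> P_c p > 0 \<and> G_m p > 0 \<and> C_L p > 0 \<and> C_N p > 0 \<and>
     eta_L p > 0 \<and> eta_N p > 0 \<and> m_L p > 0 \<and> m_N p > 0 \<and> light_speed p > 0 \<and> theta_B p > 0 \<and>
     W_b p > 0 \<and> K_B p > 0 \<and> temperature p > 0 \<and> wavelength p > 0 \<and> blockage p > 0 \<and>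
     sig_t p > 0 \<and> sig_cl p > 0 \<and> n_freq p > 0"

definition p_LOS :: "radar \<Rightarrow> real \<Rightarrow> real" where
  "p_LOS p r = exp (- blockage p * r)"

definition cell_area :: "radar \<Rightarrow> real \<Rightarrow> real \<Rightarrow> real" where
  "cell_area p r b = light_speed p * r * theta_B p / (2 * W_b p * (cos (b / 2))\<^sup>2)"

definition kappa :: "radar \<Rightarrow> real" where
  "kappa p = P_s p * (G_m p)\<^sup>2 * (wavelength p)\<^sup>2 / (4 * pi) ^ 3"

text \<open>
  The target sits at the origin. \<open>Phi_IC1\<close> and \<open>Phi_IC2\<close> are two versions of the process of
  interfering base stations: the two interference sums over it are treated as independent, which is
  impossible for sums over literally the same points.
\<close>

record 'w network =
  R_n :: "'w \<Rightarrow> real"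
  beta :: "'w \<Rightarrow> real"
  ind_c1 :: "'w \<Rightarrow> bool"
  sigma_t :: "'w \<Rightarrow> real"
  Phi_cl :: "'w \<Rightarrow> configuration"
  sigma_c :: "nat \<Rightarrow> 'w \<Rightarrow> real"
  R_IC :: "'w \<Rightarrow> real"
  beta_I :: "'w \<Rightarrow> real"
  Phi_IC1 :: "'w \<Rightarrow> configuration"
  sigma_v :: "nat \<Rightarrow> 'w \<Rightarrow> real"
  Phi_IC2 :: "'w \<Rightarrow> configuration"
  S_v :: "nat \<Rightarrow> 'w \<Rightarrow> ennreal"
  R_d :: "'w \<Rightarrow> real"
  Phi_L :: "'w \<Rightarrow> configuration"
  h_L :: "nat \<Rightarrow> 'w \<Rightarrow> real"
  Phi_N :: "'w \<Rightarrow> configuration"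
  h_N :: "nat \<Rightarrow> 'w \<Rightarrow> real"

text \<open>
  Sums over point processes are extended nonnegative reals: the direct non-line-of-sight
  interference is almost surely infinite when \<open>eta_N p \<le> 2\<close>, and then the SINR is 0.
\<close>

definition S_b :: "(real \<Rightarrow> real \<Rightarrow> (real^2) set) \<Rightarrow> 'w network \<Rightarrow> 'w \<Rightarrow> ennreal" where
  "S_b A_rb X \<omega> = sum_points
     (\<lambda>i x. ennreal (sigma_c X i \<omega>) * indicator (A_rb (R_n X \<omega>) (beta X \<omega>)) x) (Phi_cl X \<omega>)"

definition I_IC1 :: "radar \<Rightarrow> 'w network \<Rightarrow> 'w \<Rightarrow> ennreal" where
  "I_IC1 p X \<omega> = sum_points
     (\<lambda>v x. ennreal (cos (beta_I X \<omega> / 2) * norm x powr (- eta_L p) * sigma_v X v \<omega>)) (Phi_IC1 X \<omega>)"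

definition I_IC2 :: "radar \<Rightarrow> 'w network \<Rightarrow> 'w \<Rightarrow> ennreal" where
  "I_IC2 p X \<omega> = sum_points
     (\<lambda>v x. ennreal (cos (beta_I X \<omega> / 2) * norm x powr (- eta_L p)) * S_v X v \<omega>) (Phi_IC2 X \<omega>)"

definition I_L :: "radar \<Rightarrow> 'w network \<Rightarrow> 'w \<Rightarrow> ennreal" where
  "I_L p X \<omega> = sum_points
     (\<lambda>i x. ennreal (P_c p * h_L X i \<omega> * (G_m p)\<^sup>2 * C_L p * norm x powr (- eta_L p))) (Phi_L X \<omega>)"

definition I_N :: "radar \<Rightarrow> 'w network \<Rightarrow> 'w \<Rightarrow> ennreal" where
  "I_N p X \<omega> = sum_points
     (\<lambda>i x. ennreal (P_c p * h_N X i \<omega> * (G_m p)\<^sup>2 * C_N p * norm x powr (- eta_N p))) (Phi_N X \<omega>)"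

definition SINR ::
  "radar \<Rightarrow> real \<Rightarrow> (real \<Rightarrow> real \<Rightarrow> (real^2) set) \<Rightarrow> 'w network \<Rightarrow> 'w \<Rightarrow> ennreal" where
  "SINR p R1 A_rb X \<omega> =
     ennreal (of_bool (ind_c1 X \<omega>) * kappa p * sigma_t X \<omega> * cos (beta X \<omega> / 2)
              * R1 powr (- eta_L p) * R_n X \<omega> powr (- eta_L p))
     / (ennreal (kappa p * cos (beta X \<omega> / 2) * R1 powr (- eta_L p) * R_n X \<omega> powr (- eta_L p))
          * S_b A_rb X \<omega>
        + ennreal (kappa p * R_n X \<omega> powr (- eta_L p)) * (I_IC1 p X \<omega> + I_IC2 p X \<omega>)
        + ennreal (K_B p * temperature p * W_b p) + I_L p X \<omega> + I_N p X \<omega>)"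

section \<open>Distributional assumptions\<close>

definition density_R_n :: "radar \<Rightarrow> nat \<Rightarrow> real \<Rightarrow> real \<Rightarrow> real" where
  "density_R_n p n R1 r =
     2 * (lam_BS p * pi) ^ (n - 1) / fact (n - 2) * (r\<^sup>2 - R1\<^sup>2) ^ (n - 2) * r
       * exp (- lam_BS p * pi * (r\<^sup>2 - R1\<^sup>2))"

definition uniform_angle :: "'w measure \<Rightarrow> ('w \<Rightarrow> real) \<Rightarrow> bool" where
  "uniform_angle Q B \<longleftrightarrow> distributed Q lborel B (\<lambda>b. ennreal (indicator {0..pi} b / pi))"

definition resolution_cells :: "radar \<Rightarrow> real \<Rightarrow> (real \<Rightarrow> real \<Rightarrow> (real^2) set) \<Rightarrow> bool" where
  "resolution_cells p R1 A_rb \<longleftrightarrow>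
     {(r, b, x). x \<in> A_rb r b} \<in> sets borel \<and>
     (\<forall>r\<ge>R1. \<forall>b. 0 \<le> b \<longrightarrow> b < pi \<longrightarrow> emeasure lborel (A_rb r b) = ennreal (cell_area p r b))"

text \<open>In the next three definitions \<open>Q\<close> is the conditional probability given \<open>(R_n, beta)\<close>.\<close>

definition intra_clutter_model :: "radar \<Rightarrow> 'w network \<Rightarrow> 'w measure \<Rightarrow> bool" where
  "intra_clutter_model p X Q \<longleftrightarrow>
     iid_marked_ppp Q (density lborel (\<lambda>_. ennreal (lam_cl p))) (exponential_law (sig_cl p))
       (Phi_cl X) (sigma_c X)"

definition inter_clutter_model ::
  "radar \<Rightarrow> real \<Rightarrow> (real \<Rightarrow> real \<Rightarrow> (real^2) set) \<Rightarrow> 'w network \<Rightarrow> 'w measure \<Rightarrow> bool" where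
  "inter_clutter_model p R1 A_rb X Q \<longleftrightarrow>
     distributed Q lborel (R_IC X)
       (\<lambda>x. ennreal (2 * pi * lam_BS p * x * exp (- lam_BS p * pi * (x\<^sup>2 - R1\<^sup>2)))
            * indicator {R1..} x) \<and>
     uniform_angle Q (beta_I X) \<and>
     prob_space.indep_var Q borel (R_IC X) borel (beta_I X) \<and>
     conditionally_on Q borel (\<lambda>\<omega>. (R_IC X \<omega>, beta_I X \<omega>)) (\<lambda>(ric, _) Q'.
       (let \<Lambda> = exterior_intensity ric (\<lambda>r. p_LOS p r * lam_BS p / real (n_freq p)) in
        iid_marked_ppp Q' \<Lambda> (exponential_law (sig_t p)) (Phi_IC1 X) (sigma_v X) \<and>
        iid_marked_ppp Q' \<Lambda> (distr Q borel (S_b A_rb X)) (Phi_IC2 X) (S_v X) \<and>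
        prob_space.indep_var Q' borel (I_IC1 p X) borel (I_IC2 p X)))"

definition direct_interference_model :: "radar \<Rightarrow> 'w network \<Rightarrow> 'w measure \<Rightarrow> bool" where
  "direct_interference_model p X Q \<longleftrightarrow>
     distributed Q lborel (R_d X)
       (\<lambda>x. ennreal (2 * pi * lam_BS p * x * exp (- pi * lam_BS p * x\<^sup>2)) * indicator {0..} x) \<and>
     conditionally_on Q borel (R_d X) (\<lambda>rd Q'.
       poisson_point_process Q'
         (exterior_intensity rd (\<lambda>r. p_LOS p r * lam_BS p / (real (n_freq p))\<^sup>2)) (Phi_L X) \<and>
       poisson_point_process Q'
         (exterior_intensity rd (\<lambda>r. (1 - p_LOS p r) * lam_BS p / (real (n_freq p))\<^sup>2)) (Phi_N X) \<and>
       iid_with_law Q' (unit_mean_gamma_law (m_L p)) (h_L X) \<and>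
       iid_with_law Q' (unit_mean_gamma_law (m_N p)) (h_N X) \<and>
       prob_space.indep_sets Q'
         (case_sum
           (case_option (generated_events Q' configurations (Phi_L X))
                        (\<lambda>i. generated_events Q' borel (h_L X i)))
           (case_option (generated_events Q' configurations (Phi_N X))
                        (\<lambda>i. generated_events Q' borel (h_N X i)))) UNIV)"

definition bistatic_model ::
  "radar \<Rightarrow> nat \<Rightarrow> real \<Rightarrow> (real \<Rightarrow> real \<Rightarrow> (real^2) set) \<Rightarrow> 'w measure \<Rightarrow> 'w network \<Rightarrow> bool" where
  "bistatic_model p n R1 A_rb \<P> X \<longleftrightarrow>
     prob_space \<P> \<and>
     resolution_cells p R1 A_rb \<and>
     distributed \<P> lborel (R_n X) (\<lambda>r. ennreal (density_R_n p n R1 r) * indicator {R1..} r) \<and>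
     uniform_angle \<P> (beta X) \<and>
     prob_space.indep_var \<P> borel (R_n X) borel (beta X) \<and>
     conditionally_on \<P> borel (\<lambda>\<omega>. (R_n X \<omega>, beta X \<omega>)) (\<lambda>(r, _) Q.
       distr Q (count_space UNIV) (ind_c1 X)
         = measure_pmf (bernoulli_pmf (p_LOS p r * (real (n_freq p) - 1) / real (n_freq p))) \<and>
       ind_c1 X \<in> measurable Q (count_space UNIV) \<and>
       distributed Q lborel (sigma_t X) (\<lambda>x. ennreal (exponential_density (1 / sig_t p) x)) \<and>
       intra_clutter_model p X Q \<and>
       inter_clutter_model p R1 A_rb X Q \<and>
       direct_interference_model p X Q \<and>
       prob_space.indep_sets Q
         ((!) [generated_events Q (count_space UNIV) (ind_c1 X),
               generated_events Q borel (sigma_t X),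
               generated_events Q borel (S_b A_rb X),
               generated_events Q (borel \<Otimes>\<^sub>M borel) (\<lambda>\<omega>. (I_IC1 p X \<omega>, I_IC2 p X \<omega>)),
               generated_events Q (borel \<Otimes>\<^sub>M borel) (\<lambda>\<omega>. (I_L p X \<omega>, I_N p X \<omega>))]) {..<5})"

definition coverage_probability ::
  "radar \<Rightarrow> real \<Rightarrow> (real \<Rightarrow> real \<Rightarrow> (real^2) set) \<Rightarrow> 'w measure \<Rightarrow> 'w network \<Rightarrow> real \<Rightarrow> real" where
  "coverage_probability p R1 A_rb \<P> X \<phi> =
     measure \<P> {\<omega> \<in> space \<P>. SINR p R1 A_rb X \<omega> > ennreal \<phi>}"

section \<open>The functions in the coverage formula\<close>

definition exp_neg :: "ennreal \<Rightarrow> real" where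
  "exp_neg x = (if x = \<infinity> then 0 else exp (- enn2real x))"

definition C_b :: "radar \<Rightarrow> real \<Rightarrow> real \<Rightarrow> real \<Rightarrow> real" where
  "C_b p \<phi> r b = exp (- lam_cl p * cell_area p r b * (\<phi> * sig_cl p / (sig_t p + \<phi> * sig_cl p)))"

definition L_IC :: "radar \<Rightarrow> real \<Rightarrow> real \<Rightarrow> real \<Rightarrow> real \<Rightarrow> ennreal" where
  "L_IC p R1 s r b =
     (\<integral>\<^sup>+ric\<in>{R1..}. (\<integral>\<^sup>+t\<in>{0..pi}. ennreal (
        exp_neg (ennreal (2 * pi * lam_BS p / real (n_freq p)) *
          (\<integral>\<^sup>+y\<in>{ric..}. ennreal (p_LOS p y *
             (1 - 1 / (1 + s * cos (t / 2) * y powr (- eta_L p) * sig_t p)) * y) \<partial>lborel)) *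
        exp_neg (ennreal (lam_BS p / real (n_freq p)) *
          (\<integral>\<^sup>+y\<in>{ric..}. ennreal (p_LOS p y *
             (1 - exp (- lam_cl p * cell_area p r b *
                        (s * cos (t / 2) * y powr (- eta_L p) * sig_cl p /
                         (1 + s * cos (t / 2) * y powr (- eta_L p) * sig_cl p)))) *
             (2 * pi * y)) \<partial>lborel)) *
        (2 * lam_BS p * ric * exp (- lam_BS p * pi * (ric\<^sup>2 - R1\<^sup>2)))) \<partial>lborel) \<partial>lborel)"

definition L_D :: "radar \<Rightarrow> real \<Rightarrow> ennreal" where
  "L_D p s =
     (\<integral>\<^sup>+rd\<in>{0..}. ennreal (
        exp_neg (ennreal (2 * pi * lam_BS p / (real (n_freq p))\<^sup>2) *
          (\<integral>\<^sup>+y\<in>{rd..}. ennreal (p_LOS p y *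
             (1 - (1 + s * P_c p * (G_m p)\<^sup>2 * C_L p * y powr (- eta_L p) / m_L p)
                    powr (- m_L p)) * y) \<partial>lborel)) *
        exp_neg (ennreal (2 * pi * lam_BS p / (real (n_freq p))\<^sup>2) *
          (\<integral>\<^sup>+y\<in>{rd..}. ennreal ((1 - p_LOS p y) *
             (1 - (1 + s * P_c p * (G_m p)\<^sup>2 * C_N p * y powr (- eta_N p) / m_N p)
                    powr (- m_N p)) * y) \<partial>lborel)) *
        (2 * pi * lam_BS p * rd * exp (- pi * lam_BS p * rd\<^sup>2))) \<partial>lborel)"

end

theory Submission
  imports Defs
begin

text \<open>
  Given \<open>(R_n, beta) = (r, b)\<close> the event \<open>SINR > \<phi>\<close> says that reception succeeds and that the
  exponential cross-section of the target exceeds a multiple \<open>W\<close> of the denominator, which is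
  independent of it. Integrating out the cross-section gives the expectation of
  \<open>exp (- W / sig_t)\<close>, and by independence this is the product of the Laplace transforms of the
  noise, the clutter and the two kinds of interference. Each transform is a Laplace functional of a
  marked Poisson process; conditionally on the inner radius of its support it is evaluated in polar
  coordinates, and the radius is then integrated out, as are finally \<open>r\<close> and \<open>b\<close>.
\<close>

section \<open>Exponentials of extended nonnegative reals\<close>

text \<open>Interference sums may be infinite, so the whole computation stays in [0, \<infinity>]
  with the transform \<open>exp_neg\<close>, which is continuous and multiplicative there; no
  convergence condition on the path-loss exponents ever arises. Two obstacles shape the
  conditioning. The model formulas contain the conditioning variables as random variables, for
  instance \<open>cos (beta_I X \<omega> / 2)\<close>, whereas the transforms need constants: the
  definition of a regular conditional probability does not say that the kernel at z lives on the
  fibre over z, and this has to be proved. Moreover the model does not state that the SINR is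
  measurable. Its ingredients are measurable because independence under the kernel makes the sets
  they generate events, and a kernel has the same \<sigma>-algebra as the original measure, so a
  single good value of the conditioning variable suffices. The angle pi, where the cosine and hence
  the signal vanish, is discarded as a null event.\<close>

lemma exp_neg_nonneg [simp]: "0 \<le> exp_neg x"
  by (simp add: exp_neg_def)

lemma exp_neg_le_1 [simp]: "exp_neg x \<le> 1"
  by (simp add: exp_neg_def)

lemma exp_neg_0 [simp]: "exp_neg 0 = 1"
  by (simp add: exp_neg_def)

lemma exp_neg_top [simp]: "exp_neg \<top> = 0"
  by (simp add: exp_neg_def)

lemma exp_neg_ennreal: "0 \<le> x \<Longrightarrow> exp_neg (ennreal x) = exp (- x)"
  by (simp add: exp_neg_def)

lemma exp_neg_add: "exp_neg (x + y) = exp_neg x * exp_neg y"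
  by (cases x; cases y) (simp_all add: exp_neg_def exp_add[symmetric] flip: ennreal_plus)

lemma exp_neg_antimono: "x \<le> y \<Longrightarrow> exp_neg y \<le> exp_neg x"
  by (auto simp: le_iff_add exp_neg_add mult_left_le)

lemma exp_neg_sum: "exp_neg (sum f A) = (\<Prod>i\<in>A. exp_neg (f i))"
  by (induction A rule: infinite_finite_induct) (simp_all add: exp_neg_add)

lemma exp_neg_measurable [measurable]: "exp_neg \<in> borel_measurable borel"
  unfolding exp_neg_def[abs_def] by measurable

text \<open>The convention exp(-\<infinity>) = 0 is what makes the map continuous at \<top>; near a
  finite limit the values are eventually finite and the real exponential takes over.\<close>

lemma tendsto_exp_neg:
  assumes "(X \<longlongrightarrow> x) F"
  shows "((\<lambda>i. exp_neg (X i)) \<longlongrightarrow> exp_neg x) F"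
proof (cases "x = \<top>")
  case True
  show ?thesis
  proof (rule order_tendstoI)
    fix a assume "exp_neg x < a"
    then have a: "0 < a" using True by simp
    \<comment> \<open>Any finite level above - ln a would do; the absolute value keeps it
      nonnegative, since \<open>ennreal\<close> truncates negative reals to 0.\<close>
    have "\<forall>\<^sub>F i in F. ennreal (\<bar>ln a\<bar> + 1) < X i"
      using assms True by (intro order_tendstoD(1)) auto
    then show "\<forall>\<^sub>F i in F. exp_neg (X i) < a"
    proof eventually_elim
      case (elim i)
      have "exp (- enn2real (X i)) < a" if "X i \<noteq> \<top>"
      proof -
        have "\<bar>ln a\<bar> + 1 < enn2real (X i)"
          using elim that by (cases "X i") (auto simp: ennreal_less_iff simp del: ennreal_plus)
        then have "- enn2real (X i) < ln a" by linarith
        then have "exp (- enn2real (X i)) < exp (ln a)" by simp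
        then show ?thesis using a by simp
      qed
      then show ?case using a by (auto simp: exp_neg_def)
    qed
  next
    fix a assume "a < exp_neg x"
    then have "a < 0" using True by simp
    then show "\<forall>\<^sub>F i in F. a < exp_neg (X i)"
      by (intro always_eventually allI) (meson exp_neg_nonneg less_le_trans)
  qed
next
  case False
  then obtain r where r: "x = ennreal r" "0 \<le> r" by (cases x) auto
  have "((\<lambda>i. exp (- enn2real (X i))) \<longlongrightarrow> exp (- r)) F"
    using assms r by (intro tendsto_exp tendsto_minus tendsto_enn2real) auto
  moreover have "\<forall>\<^sub>F i in F. X i < \<top>"
    using assms False by (intro order_tendstoD(2)) (auto simp: less_top)
  then have "\<forall>\<^sub>F i in F. exp (- enn2real (X i)) = exp_neg (X i)"
    by eventually_elim (auto simp: exp_neg_def)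
  ultimately show ?thesis
    using r by (simp add: exp_neg_ennreal tendsto_cong)
qed

lemma exp_neg_suminf: "(\<lambda>N. \<Prod>i<N. exp_neg (f i)) \<longlonglongrightarrow> exp_neg (\<Sum>i. f i)"
  using tendsto_exp_neg[OF summable_LIMSEQ[of f]] by (simp add: exp_neg_sum)

text \<open>Dominated convergence with majorant 1. It serves for passing from simple functions to a
  general weight and for adding the points of a configuration one at a time.\<close>

lemma (in finite_measure) nn_integral_bounded_convergence:
  fixes u :: "nat \<Rightarrow> 'a \<Rightarrow> real"
  assumes [measurable]: "\<And>i. u i \<in> borel_measurable M"
    and b: "\<And>i x. x \<in> space M \<Longrightarrow> 0 \<le> u i x \<and> u i x \<le> 1"
    and l: "\<And>x. x \<in> space M \<Longrightarrow> (\<lambda>i. u i x) \<longlonglongrightarrow> v x"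
  shows "(\<lambda>i. \<integral>\<^sup>+x. ennreal (u i x) \<partial>M) \<longlonglongrightarrow> (\<integral>\<^sup>+x. ennreal (v x) \<partial>M)"
proof (rule nn_integral_dominated_convergence[where w="\<lambda>_. 1"])
  have "v \<in> borel_measurable M"
    by (rule borel_measurable_LIMSEQ_real[OF l]) auto
  then show "(\<lambda>x. ennreal (v x)) \<in> borel_measurable M" by simp
  show "(\<integral>\<^sup>+x. 1 \<partial>M) < \<infinity>" by (simp add: less_top[symmetric])
  show "AE x in M. (\<lambda>i. ennreal (u i x)) \<longlonglongrightarrow> ennreal (v x)"
    using l by (auto intro!: AE_I2 tendsto_ennrealI)
qed (use b in \<open>auto intro!: AE_I2\<close>)

section \<open>Independence of generated events\<close>

lemma generated_events_Int_stable: "Int_stable (generated_events M N X)"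
  unfolding Int_stable_def generated_events_def
proof safe
  fix A B assume "A \<in> sets N" "B \<in> sets N"
  then show "\<exists>C. (X -` A \<inter> space M) \<inter> (X -` B \<inter> space M) = X -` C \<inter> space M \<and> C \<in> sets N"
    by (intro exI[of _ "A \<inter> B"]) auto
qed

lemma measurable_generated_events:
  assumes "X \<in> space M \<rightarrow> space N"
  shows "X \<in> measurable (sigma (space M) (generated_events M N X)) N"
proof (rule measurableI)
  have *: "generated_events M N X \<subseteq> Pow (space M)"
    by (auto simp: generated_events_def)
  show "X x \<in> space N" if "x \<in> space (sigma (space M) (generated_events M N X))" for x
    using that assms * by auto
  show "X -` A \<inter> space (sigma (space M) (generated_events M N X))
      \<in> sets (sigma (space M) (generated_events M N X))" if "A \<in> sets N" for A
    using * that by (auto simp: generated_events_def intro!: sigma_sets.Basic)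
qed

text \<open>Independence of families of sets includes that their members are events, so an
  independence hypothesis carries measurability with it. The clutter and interference sums obtain
  theirs in this way.\<close>

lemma (in prob_space) generated_events_measurableD:
  assumes "indep_sets F I" "i \<in> I" "F i = generated_events M N X" "X \<in> space M \<rightarrow> space N"
  shows "X \<in> measurable M N"
proof (rule measurableI)
  show "X x \<in> space N" if "x \<in> space M" for x
    using that assms by auto
  show "X -` A \<inter> space M \<in> events" if "A \<in> sets N" for A
  proof -
    have "F i \<subseteq> events" using assms(1,2) by (auto simp: indep_sets_def)
    then show ?thesis using that assms(3) by (auto simp: generated_events_def)
  qed
qed

text \<open>
  Independence of set families becomes independence of random variables of one single type, namely
  of copies of the identity with values in the generated sub-\<open>\<sigma>\<close>-algebras. This makes the library
  on independent variables applicable to variables of different types.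
\<close>

lemma (in prob_space) indep_sets_imp_indep_vars_identity:
  assumes "indep_sets F I" "\<And>i. i \<in> I \<Longrightarrow> Int_stable (F i)"
  shows "indep_vars (\<lambda>i. sigma (space M) (F i)) (\<lambda>_ \<omega>. \<omega>) I"
proof -
  have F: "F i \<subseteq> events" "F i \<subseteq> Pow (space M)" if "i \<in> I" for i
    using assms(1) that sets.sets_into_space by (auto simp: indep_sets_def)
  have ss: "sigma_sets (space M) (F i) \<subseteq> events" if "i \<in> I" for i
    using F[OF that] by (simp add: sets.sigma_sets_subset)
  show ?thesis
    unfolding indep_vars_def2
  proof (intro conjI ballI)
    fix i assume i: "i \<in> I"
    show "(\<lambda>\<omega>. \<omega>) \<in> measurable M (sigma (space M) (F i))"
      using F[OF i] by (intro measurable_measure_of) auto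
  next
    show "indep_sets (\<lambda>i. {(\<lambda>\<omega>. \<omega>) -` A \<inter> space M |A. A \<in> sets (sigma (space M) (F i))}) I"
    proof (rule indep_sets_mono_sets[OF indep_sets_sigma[OF assms]])
      fix i assume i: "i \<in> I"
      show "{(\<lambda>\<omega>. \<omega>) -` A \<inter> space M |A. A \<in> sets (sigma (space M) (F i))} \<subseteq> sigma_sets (space M) (F i)"
        using F[OF i] sigma_sets_into_sp[of "F i" "space M"] by (auto simp: Int_absorb2)
    qed auto
  qed
qed

text \<open>Decoupling. The vector \<open>restrict (\<lambda>_. \<omega>) J\<close> has all entries
  equal to \<omega>, but its i-th entry is seen only through the \<sigma>-algebra
  \<open>N i\<close>. An integrand that reads some ingredients through J and the others through K
  may therefore read the latter at an independent copy of \<omega>.\<close>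

lemma (in prob_space) indep_vars_nn_integral_split:
  assumes ind: "indep_vars N (\<lambda>_ \<omega>. \<omega>) I" and JK: "J \<inter> K = {}" "J \<subseteq> I" "K \<subseteq> I"
    and G [measurable]: "G \<in> borel_measurable (PiM J N \<Otimes>\<^sub>M PiM K N)"
  shows "(\<integral>\<^sup>+\<omega>. G (restrict (\<lambda>_. \<omega>) J, restrict (\<lambda>_. \<omega>) K) \<partial>M) =
    (\<integral>\<^sup>+\<omega>. \<integral>\<^sup>+\<omega>'. G (restrict (\<lambda>_. \<omega>) J, restrict (\<lambda>_. \<omega>') K) \<partial>M \<partial>M)"
proof -
  define U where "U = (\<lambda>\<omega>::'a. restrict (\<lambda>_. \<omega>) J)"
  define V where "V = (\<lambda>\<omega>::'a. restrict (\<lambda>_. \<omega>) K)"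
  have "indep_var (PiM J N) U (PiM K N) V"
    unfolding U_def V_def by (rule indep_var_restrict[OF ind JK])
  then have [measurable]: "random_variable (PiM J N) U" "random_variable (PiM K N) V"
    and eq: "distr M (PiM J N) U \<Otimes>\<^sub>M distr M (PiM K N) V = distr M (PiM J N \<Otimes>\<^sub>M PiM K N) (\<lambda>x. (U x, V x))"
    by (auto simp: indep_var_distribution_eq)
  interpret V: prob_space "distr M (PiM K N) V" by (rule prob_space_distr) simp
  have "(\<integral>\<^sup>+\<omega>. G (U \<omega>, V \<omega>) \<partial>M) = (\<integral>\<^sup>+z. G z \<partial>distr M (PiM J N \<Otimes>\<^sub>M PiM K N) (\<lambda>x. (U x, V x)))"
    by (subst nn_integral_distr) auto
  also have "\<dots> = (\<integral>\<^sup>+u. \<integral>\<^sup>+v. G (u, v) \<partial>distr M (PiM K N) V \<partial>distr M (PiM J N) U)"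
    unfolding eq[symmetric]
    by (rule V.nn_integral_fst[symmetric]) (simp cong: measurable_cong_sets)
  also have "\<dots> = (\<integral>\<^sup>+u. \<integral>\<^sup>+\<omega>'. G (u, V \<omega>') \<partial>M \<partial>distr M (PiM J N) U)"
    by (intro nn_integral_cong nn_integral_distr) auto
  also have "\<dots> = (\<integral>\<^sup>+\<omega>. \<integral>\<^sup>+\<omega>'. G (U \<omega>, V \<omega>') \<partial>M \<partial>M)"
    by (subst nn_integral_distr) auto
  finally show ?thesis by (simp add: U_def V_def)
qed

lemma (in prob_space) indep_var_nn_integral_mult:
  fixes U V :: "'a \<Rightarrow> ennreal"
  assumes "indep_var borel U borel V"
  shows "(\<integral>\<^sup>+\<omega>. U \<omega> * V \<omega> \<partial>M) = (\<integral>\<^sup>+\<omega>. U \<omega> \<partial>M) * (\<integral>\<^sup>+\<omega>. V \<omega> \<partial>M)"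
proof -
  have [measurable]: "U \<in> borel_measurable M" "V \<in> borel_measurable M"
    and eq: "distr M borel U \<Otimes>\<^sub>M distr M borel V = distr M (borel \<Otimes>\<^sub>M borel) (\<lambda>x. (U x, V x))"
    using assms by (auto simp: indep_var_distribution_eq)
  interpret V: prob_space "distr M borel V" by (rule prob_space_distr) simp
  have "(\<integral>\<^sup>+\<omega>. U \<omega> * V \<omega> \<partial>M) = (\<integral>\<^sup>+z. fst z * snd z \<partial>(distr M borel U \<Otimes>\<^sub>M distr M borel V))"
    unfolding eq by (subst nn_integral_distr) auto
  also have "\<dots> = (\<integral>\<^sup>+u. \<integral>\<^sup>+v. u * v \<partial>distr M borel V \<partial>distr M borel U)"
    by (subst V.nn_integral_fst[symmetric]) auto
  also have "\<dots> = (\<integral>\<^sup>+u. u \<partial>distr M borel U) * (\<integral>\<^sup>+v. v \<partial>distr M borel V)"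
    by (simp add: nn_integral_cmult nn_integral_multc)
  finally show ?thesis by (simp add: nn_integral_distr)
qed

text \<open>The independence hypothesis for the direct interference is indexed by a sum type; with
  \<open>Inl\<close> or \<open>Inr\<close> for h this isolates one of the two marked
  processes.\<close>

lemma (in prob_space) indep_sets_reindex:
  assumes "indep_sets F (h ` I)" "inj_on h I"
  shows "indep_sets (\<lambda>i. F (h i)) I"
proof (rule indep_setsI)
  show "F (h i) \<subseteq> events" if "i \<in> I" for i
    using assms(1) that by (auto simp: indep_sets_def)
next
  fix A J assume J: "J \<noteq> {}" "J \<subseteq> I" "finite J" "\<forall>j\<in>J. A j \<in> F (h j)"
  have inj: "inj_on h J" using assms(2) J(2) by (rule inj_on_subset)
  have "prob (\<Inter>k\<in>h ` J. A (the_inv_into J h k)) = (\<Prod>k\<in>h ` J. prob (A (the_inv_into J h k)))"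
    using J inj by (intro indep_setsD[OF assms(1)]) (auto simp: the_inv_into_f_f)
  then show "prob (\<Inter>j\<in>J. A j) = (\<Prod>j\<in>J. prob (A j))"
    using inj by (simp add: prod.reindex the_inv_into_f_f)
qed

section \<open>Regular conditional probabilities\<close>

lemma regular_conditional_probability_kernel:
  assumes "regular_conditional_probability M N X K" "z \<in> space N"
  shows "prob_space (K z)" "sets (K z) = sets M" "space (K z) = space M"
proof -
  have "K z \<in> space (prob_algebra M)"
    using assms by (auto simp: regular_conditional_probability_def dest: measurable_space)
  then show "prob_space (K z)" "sets (K z) = sets M"
    by (auto simp: space_prob_algebra)
  then show "space (K z) = space M" by (metis sets_eq_imp_space_eq)
qed

text \<open>Taking the whole space for B in the defining identity shows that M is the mixture of the
  kernels over the law of X; the tower rule is then integration against a bind.\<close>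

lemma nn_integral_regular_conditional_probability:
  assumes M: "prob_space M" and K: "regular_conditional_probability M N X K"
    and f: "f \<in> borel_measurable M"
  shows "(\<integral>\<^sup>+\<omega>. f \<omega> \<partial>M) = (\<integral>\<^sup>+z. (\<integral>\<^sup>+\<omega>. f \<omega> \<partial>K z) \<partial>distr M N X)"
    and "(\<lambda>z. \<integral>\<^sup>+\<omega>. f \<omega> \<partial>K z) \<in> borel_measurable N"
proof -
  interpret prob_space M by fact
  have X [measurable]: "X \<in> measurable M N" and Km: "K \<in> measurable N (prob_algebra M)"
    using K by (auto simp: regular_conditional_probability_def)
  then have Ks [measurable]: "K \<in> measurable N (subprob_algebra M)"
    by (simp add: measurable_prob_algebraD)
  interpret D: prob_space "distr M N X" by (rule prob_space_distr) simp
  have "M = distr M N X \<bind> K"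
  proof (rule measure_eqI)
    show "sets M = sets (distr M N X \<bind> K)"
      by (subst sets_bind[where N=M]) (use K D.not_empty in \<open>auto simp: regular_conditional_probability_kernel\<close>)
    fix A assume A: "A \<in> sets M"
    have "emeasure (distr M N X \<bind> K) A = (\<integral>\<^sup>+z. emeasure (K z) A \<partial>distr M N X)"
      using A by (intro emeasure_bind[where N=M] D.not_empty) (auto cong: measurable_cong_sets)
    also have "\<dots> = (\<integral>\<^sup>+z\<in>space N. emeasure (K z) A \<partial>distr M N X)"
      by (intro nn_integral_cong) auto
    also have "\<dots> = emeasure M (X -` space N \<inter> A)"
      using K A by (simp add: regular_conditional_probability_def)
    also have "X -` space N \<inter> A = A"
      using measurable_space[OF X] sets.sets_into_space[OF A] by auto
    finally show "emeasure M A = emeasure (distr M N X \<bind> K) A" ..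
  qed
  then have "(\<integral>\<^sup>+\<omega>. f \<omega> \<partial>M) = (\<integral>\<^sup>+\<omega>. f \<omega> \<partial>(distr M N X \<bind> K))" by simp
  also have "\<dots> = (\<integral>\<^sup>+z. (\<integral>\<^sup>+\<omega>. f \<omega> \<partial>K z) \<partial>distr M N X)"
    using f by (intro nn_integral_bind[where B=M]) (auto cong: measurable_cong_sets)
  finally show "(\<integral>\<^sup>+\<omega>. f \<omega> \<partial>M) = (\<integral>\<^sup>+z. (\<integral>\<^sup>+\<omega>. f \<omega> \<partial>K z) \<partial>distr M N X)" .
  show "(\<lambda>z. \<integral>\<^sup>+\<omega>. f \<omega> \<partial>K z) \<in> borel_measurable N"
    by (rule measurable_compose[OF Ks nn_integral_measurable_subprob_algebra[OF f]])
qed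

text \<open>For a basic open set U, the defining identity with the event that X avoids U integrates
  to 0 over U. The base is countable, so for almost every z, almost surely under the kernel X lies
  in every basic neighbourhood of z, and the T1 property forces X = z.\<close>

lemma regular_conditional_probability_AE_eq:
  fixes X :: "'w \<Rightarrow> 'a :: {second_countable_topology, t1_space}"
  assumes M: "prob_space M" and K: "regular_conditional_probability M borel X K"
  shows "AE z in distr M borel X. AE \<omega> in K z. X \<omega> = z"
proof -
  obtain \<B> :: "'a set set" where \<B>: "countable \<B>" "topological_basis \<B>"
    using ex_countable_basis by blast
  have X [measurable]: "X \<in> borel_measurable M" and Km: "K \<in> measurable borel (prob_algebra M)"
    using K by (auto simp: regular_conditional_probability_def)
  then have [measurable]: "K \<in> measurable borel (subprob_algebra M)"
    by (simp add: measurable_prob_algebraD)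
  have U: "AE z in distr M borel X. z \<in> U \<longrightarrow> (AE \<omega> in K z. X \<omega> \<in> U)" if "U \<in> \<B>" for U
  proof -
    have [measurable]: "U \<in> sets borel"
      using topological_basis_open[OF \<B>(2) that] by simp
    let ?A = "X -` (- U) \<inter> space M"
    have A [measurable]: "?A \<in> sets M" by measurable
    have "(\<integral>\<^sup>+z\<in>U. emeasure (K z) ?A \<partial>distr M borel X) = emeasure M (X -` U \<inter> ?A)"
      using K A by (simp add: regular_conditional_probability_def)
    also have "X -` U \<inter> ?A = {}" by auto
    finally have "(\<integral>\<^sup>+z\<in>U. emeasure (K z) ?A \<partial>distr M borel X) = 0" by simp
    then have "AE z in distr M borel X. emeasure (K z) ?A * indicator U z = 0"
      by (subst (asm) nn_integral_0_iff_AE) (auto cong: measurable_cong_sets)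
    then show ?thesis
    proof eventually_elim
      case (elim z)
      note Kz = regular_conditional_probability_kernel[OF K, of z]
      show ?case
      proof
        assume "z \<in> U"
        then have "emeasure (K z) ?A = 0" using elim by simp
        then show "AE \<omega> in K z. X \<omega> \<in> U"
          using Kz A by (intro AE_I[of _ _ ?A]) auto
      qed
    qed
  qed
  have "AE z in distr M borel X. \<forall>U\<in>\<B>. z \<in> U \<longrightarrow> (AE \<omega> in K z. X \<omega> \<in> U)"
    using U by (subst AE_ball_countable[OF \<B>(1)]) auto
  then show ?thesis
  proof eventually_elim
    case (elim z)
    then have "AE \<omega> in K z. \<forall>U\<in>\<B>. z \<in> U \<longrightarrow> X \<omega> \<in> U"
      by (subst AE_ball_countable[OF \<B>(1)]) auto
    then show ?case
    proof eventually_elim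
      case (elim \<omega>)
      show "X \<omega> = z"
      proof (rule ccontr)
        assume "X \<omega> \<noteq> z"
        then obtain W where "open W" "z \<in> W" "X \<omega> \<notin> W" using t1_space by metis
        then obtain U where "U \<in> \<B>" "z \<in> U" "U \<subseteq> W"
          using topological_basisE[OF \<B>(2)] by metis
        then show False using elim \<open>X \<omega> \<notin> W\<close> by auto
      qed
    qed
  qed
qed

section \<open>Polar coordinates\<close>

text \<open>Half-lines form an intersection-stable generator, and on them both measures give the
  area of a disc.\<close>

lemma distr_norm_lborel:
  "distr (lborel :: (real^2) measure) borel norm = density lborel (\<lambda>r. ennreal (2 * pi * r) * indicator {0..} r)"
    (is "?L = ?R")
proof (rule measure_eqI_generator_eq[where E="range atMost" and A="\<lambda>i. {..real i}" and \<Omega>=UNIV])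
  have L: "emeasure ?L {..a} = (if 0 \<le> a then ennreal (pi * a\<^sup>2) else 0)" for a :: real
  proof -
    have "emeasure ?L {..a} = emeasure lborel {x :: real^2. norm x \<le> a}"
      by (subst emeasure_distr) (auto simp: vimage_def)
    also have "{x :: real^2. norm x \<le> a} = (if 0 \<le> a then cball 0 a else {})"
      by (auto simp: not_le) (meson norm_ge_zero order_trans not_le)
    finally show ?thesis
      by (auto simp: emeasure_cball unit_ball_vol_2)
  qed
  have R: "emeasure ?R {..a} = (if 0 \<le> a then ennreal (pi * a\<^sup>2) else 0)" for a :: real
  proof -
    have "emeasure ?R {..a} = (\<integral>\<^sup>+r. ennreal (2 * pi * r) * indicator {0..a} r \<partial>lborel)"
      by (subst emeasure_density) (auto intro!: nn_integral_cong split: split_indicator)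
    also have "\<dots> = (if 0 \<le> a then ennreal (pi * a\<^sup>2) else 0)"
    proof (cases "0 \<le> a")
      case True
      have "(\<integral>\<^sup>+r. ennreal (2 * pi * r) * indicator {0..a} r \<partial>lborel) = pi * a\<^sup>2 - pi * 0\<^sup>2"
        using True by (intro nn_integral_FTC_Icc) (auto intro!: derivative_eq_intros)
      then show ?thesis using True by simp
    qed simp
    finally show ?thesis .
  qed
  show "emeasure ?L X = emeasure ?R X" if "X \<in> range atMost" for X
    using that L R by auto
  show "emeasure ?L {..real i} \<noteq> \<infinity>" for i
    by (simp add: L)
  show "(\<Union>i. {..real i}) = UNIV"
    by (auto intro: real_arch_simple)
  show "Int_stable (range (atMost :: real \<Rightarrow> _))"
    by (auto simp: Int_stable_def)
qed (auto simp: borel_eq_atMost)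

lemma nn_integral_norm_lborel:
  assumes [measurable]: "F \<in> borel_measurable borel"
  shows "(\<integral>\<^sup>+x. F (norm x) \<partial>(lborel :: (real^2) measure)) = (\<integral>\<^sup>+r\<in>{0..}. ennreal (2 * pi * r) * F r \<partial>lborel)"
proof -
  have "(\<integral>\<^sup>+x. F (norm x) \<partial>(lborel :: (real^2) measure)) = (\<integral>\<^sup>+r. F r \<partial>distr (lborel :: (real^2) measure) borel norm)"
    by (subst nn_integral_distr) auto
  also have "\<dots> = (\<integral>\<^sup>+r\<in>{0..}. ennreal (2 * pi * r) * F r \<partial>lborel)"
    unfolding distr_norm_lborel
    by (subst nn_integral_density) (auto intro!: nn_integral_cong simp: mult_ac)
  finally show ?thesis .
qed

lemma nn_integral_exterior_intensity:
  assumes [measurable]: "g \<in> borel_measurable borel" "F \<in> borel_measurable borel" and "0 \<le> R"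
  shows "(\<integral>\<^sup>+x. F (norm x) \<partial>exterior_intensity R g) =
    (\<integral>\<^sup>+r\<in>{R..}. ennreal (2 * pi * r) * ennreal (g r) * F r \<partial>lborel)"
proof -
  have "(\<integral>\<^sup>+x. F (norm x) \<partial>exterior_intensity R g) =
      (\<integral>\<^sup>+x. (\<lambda>r. ennreal (g r) * indicator {R<..} r * F r) (norm x) \<partial>(lborel :: (real^2) measure))"
    unfolding exterior_intensity_def
    by (subst nn_integral_density) (auto intro!: nn_integral_cong simp: indicator_def)
  also have "\<dots> = (\<integral>\<^sup>+r\<in>{0..}. ennreal (2 * pi * r) * (ennreal (g r) * indicator {R<..} r * F r) \<partial>lborel)"
    by (rule nn_integral_norm_lborel) simp
  also have "\<dots> = (\<integral>\<^sup>+r\<in>{R..}. ennreal (2 * pi * r) * ennreal (g r) * F r \<partial>lborel)"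
  proof (rule nn_integral_cong_AE)
    \<comment> \<open>The model has points strictly outside the disc, while the formula integrates
      over a closed half-line; they differ in one null point.\<close>
    have "AE r in lborel. r \<noteq> R" by (rule AE_lborel_singleton)
    then show "AE r in lborel. ennreal (2 * pi * r) * (ennreal (g r) * indicator {R<..} r * F r) * indicator {0..} r =
        ennreal (2 * pi * r) * ennreal (g r) * F r * indicator {R..} r"
      by eventually_elim (use \<open>0 \<le> R\<close> in \<open>auto split: split_indicator simp: mult_ac\<close>)
  qed
  finally show ?thesis .
qed

lemma sets_exterior_intensity [measurable_cong]: "sets (exterior_intensity R g) = sets borel"
  by (simp add: exterior_intensity_def)

lemma sigma_finite_exterior_intensity:
  assumes [measurable]: "g \<in> borel_measurable borel"
  shows "sigma_finite_measure (exterior_intensity R g)"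
  unfolding exterior_intensity_def
  by (subst sigma_finite_measure.sigma_finite_iff_density_finite[OF sigma_finite_lborel]) (auto simp: indicator_def)

section \<open>Laplace functional of a Poisson point process\<close>

text \<open>The source space N is arbitrary so that the lemma applies both on the probability space
  and on products of sub-\<sigma>-algebras, where points and marks are read from different
  coordinates.\<close>

lemma measurable_sum_points_marked:
  fixes H :: "nat \<Rightarrow> 'v \<Rightarrow> 'a"
  assumes \<Phi>: "\<Phi> \<in> measurable N configurations" and H [measurable]: "\<And>i. H i \<in> measurable N D"
    and f [measurable]: "f \<in> borel_measurable (borel \<Otimes>\<^sub>M D)"
  shows "(\<lambda>v. sum_points (\<lambda>i x. f (x, H i v)) (\<Phi> v)) \<in> borel_measurable N"
proof -
  note \<Phi>' = \<Phi>[unfolded configurations_def]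
  have [measurable]: "(\<lambda>v. fst (\<Phi> v)) \<in> measurable N (count_space UNIV)"
    by (rule measurable_compose[OF \<Phi>' measurable_fst])
  have [measurable]: "(\<lambda>v. snd (\<Phi> v) i) \<in> borel_measurable N" for i
    by (rule measurable_compose[OF measurable_compose[OF \<Phi>' measurable_snd]])
      (rule measurable_component_singleton, simp)
  show ?thesis
    unfolding sum_points_def by measurable
qed

lemma measurable_sum_points:
  assumes [measurable]: "f \<in> borel_measurable borel"
  shows "sum_points (\<lambda>_. f) \<in> borel_measurable configurations"
proof -
  \<comment> \<open>An unmarked sum is a marked one with marks in a one-point space.\<close>
  have "(\<lambda>v. sum_points (\<lambda>i x. (\<lambda>(x, _). f x) (x, (\<lambda>_ _. ()) i v)) v) \<in> borel_measurable configurations"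
    by (rule measurable_sum_points_marked[where D="count_space UNIV"]) auto
  then show ?thesis by simp
qed

lemma count_in_eq_sum_points: "count_in A \<phi> = sum_points (\<lambda>_. indicator A) \<phi>"
proof -
  have "count_in A \<phi> = (\<integral>\<^sup>+i. indicator {i. enat i < fst \<phi> \<and> snd \<phi> i \<in> A} i \<partial>count_space UNIV)"
    unfolding count_in_def by (subst nn_integral_indicator) auto
  also have "\<dots> = sum_points (\<lambda>_. indicator A) \<phi>"
    unfolding sum_points_def nn_integral_count_space_nat
    by (intro suminf_cong) (auto simp: indicator_def)
  finally show ?thesis .
qed

lemma sum_points_sum: "sum_points (\<lambda>i x. \<Sum>j\<in>J. f j i x) \<phi> = (\<Sum>j\<in>J. sum_points (f j) \<phi>)"
  unfolding sum_points_def nn_integral_count_space_nat[symmetric]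
  by (subst nn_integral_sum[symmetric]) (auto intro!: nn_integral_cong)

lemma sum_points_cmult: "sum_points (\<lambda>i x. c * f i x) \<phi> = c * sum_points f \<phi>"
  unfolding sum_points_def nn_integral_count_space_nat[symmetric]
  by (subst nn_integral_cmult[symmetric]) (auto intro!: nn_integral_cong)

text \<open>The exponential series, evaluated at l * exp(-a), is the generating function of the
  Poisson count.\<close>

lemma poisson_count_laplace:
  assumes M: "prob_space M" and P: "poisson_point_process M \<Lambda> \<Phi>"
    and A: "A \<in> sets borel" "emeasure \<Lambda> A < \<infinity>" and a: "a \<noteq> \<top>"
  shows "(\<integral>\<^sup>+\<omega>. ennreal (exp_neg (a * count_in A (\<Phi> \<omega>))) \<partial>M) =
    ennreal (exp_neg (ennreal (1 - exp_neg a) * emeasure \<Lambda> A))"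
proof -
  interpret prob_space M by fact
  obtain r where r: "a = ennreal r" "0 \<le> r" using a by (cases a) auto
  define l where "l = measure \<Lambda> A"
  have l: "0 \<le> l" "emeasure \<Lambda> A = ennreal l"
    using A(2) by (simp_all add: l_def emeasure_eq_ennreal_measure)
  have [measurable]: "\<Phi> \<in> measurable M configurations"
    using P by (simp add: poisson_point_process_def)
  have [measurable]: "count_in A \<in> borel_measurable configurations"
    unfolding count_in_eq_sum_points[abs_def] using A(1) by (intro measurable_sum_points) simp
  define N where "N = (\<lambda>\<omega>. count_in A (\<Phi> \<omega>))"
  have N [measurable]: "N \<in> borel_measurable M" unfolding N_def by simp
  define B where "B k = {\<omega>\<in>space M. N \<omega> = of_nat k}" for k :: nat
  have B [measurable]: "B k \<in> sets M" for k unfolding B_def by simp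
  have disj: "disjoint_family B"
    by (auto simp: disjoint_family_on_def B_def)
  have pB: "prob (B k) = l ^ k / fact k * exp (- l)" for k
    using P A unfolding poisson_point_process_def B_def N_def l_def by blast
  have sums: "(\<lambda>k. (l * c) ^ k / fact k * exp (- l)) sums (exp (l * c) * exp (- l))" for c
    by (intro sums_mult2) (use exp_converges[of "l * c"] in \<open>simp add: divide_inverse mult.commute\<close>)
  \<comment> \<open>The definition of the process prescribes only the probabilities of finite
    counts. They sum to 1, which excludes an infinite count almost surely.\<close>
  have "prob (\<Union>k. B k) = 1"
  proof (rule sums_unique2)
    show "(\<lambda>k. prob (B k)) sums prob (\<Union>k. B k)"
      using B disj by (intro finite_measure_UNION) auto
    show "(\<lambda>k. prob (B k)) sums 1"
      using sums[of 1] by (simp add: pB exp_minus)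
  qed
  then have AE: "AE \<omega> in M. \<omega> \<in> (\<Union>k. B k)"
    by (subst (asm) prob_eq_1) auto
  have "(\<integral>\<^sup>+\<omega>. ennreal (exp_neg (a * N \<omega>)) \<partial>M) =
      (\<integral>\<^sup>+\<omega>. (\<Sum>k. ennreal (exp (- r) ^ k) * indicator (B k) \<omega>) \<partial>M)"
    using AE
  proof (intro nn_integral_cong_AE, eventually_elim)
    case (elim \<omega>)
    then obtain k where k: "\<omega> \<in> B k" by auto
    then have "a * N \<omega> = ennreal (r * real k)"
      using r by (simp add: B_def ennreal_mult'' ennreal_of_nat_eq_real_of_nat)
    then have "exp_neg (a * N \<omega>) = exp (- r) ^ k"
      using r by (simp add: exp_neg_ennreal exp_of_nat_mult[symmetric] mult.commute)
    then show ?case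
      using suminf_cmult_indicator[OF disj k, of "\<lambda>k. ennreal (exp (- r) ^ k)"] by simp
  qed
  also have "\<dots> = (\<Sum>k. ennreal (exp (- r) ^ k) * emeasure M (B k))"
    by (subst nn_integral_suminf) (auto intro!: suminf_cong nn_integral_cmult_indicator)
  also have "\<dots> = (\<Sum>k. ennreal ((l * exp (- r)) ^ k / fact k * exp (- l)))"
    using l by (intro suminf_cong)
      (simp add: emeasure_eq_measure pB ennreal_mult[symmetric] power_mult_distrib mult_ac)
  also have "\<dots> = ennreal (exp (l * exp (- r)) * exp (- l))"
    using l sums[of "exp (- r)"] by (intro suminf_ennreal_eq) auto
  also have "exp (l * exp (- r)) * exp (- l) = exp (- ((1 - exp (- r)) * l))"
    by (simp add: exp_add[symmetric] algebra_simps)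
  also have "\<dots> = exp_neg (ennreal (1 - exp_neg a) * emeasure \<Lambda> A)"
    using l r by (simp add: exp_neg_ennreal ennreal_mult[symmetric])
  finally show ?thesis by (simp add: N_def)
qed

text \<open>The level sets of F are disjoint, so their counts are independent; the transform becomes
  a product of Poisson count transforms, and the exponents add up to the integral.\<close>

lemma poisson_laplace_functional_simple:
  assumes M: "prob_space M" and P: "poisson_point_process M \<Lambda> \<Phi>"
    and \<Lambda>: "sets \<Lambda> = sets borel"
    and F: "simple_function borel F" "\<And>x. F x \<noteq> \<top>" "emeasure \<Lambda> {x. F x \<noteq> 0} < \<infinity>"
  shows "(\<integral>\<^sup>+\<omega>. ennreal (exp_neg (sum_points (\<lambda>_. F) (\<Phi> \<omega>))) \<partial>M) =
    ennreal (exp_neg (\<integral>\<^sup>+x. ennreal (1 - exp_neg (F x)) \<partial>\<Lambda>))"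
proof -
  interpret prob_space M by fact
  note [measurable_cong] = \<Lambda>
  have [measurable]: "F \<in> borel_measurable borel" using F(1) by (rule borel_measurable_simple_function)
  \<comment> \<open>The value 0 is left out because its level set may have infinite
    intensity.\<close>
  define V where "V = range F - {0}"
  have "finite V" using simple_functionD(1)[OF F(1)] by (simp add: V_def)
  then obtain e where e: "bij_betw e {..<card V} V"
    using ex_bij_betw_nat_finite[of V] by (auto simp: lessThan_atLeast0)
  define m where "m = card V"
  have inj: "i = j" if "e i = e j" "i < m" "j < m" for i j
    using e that by (auto simp: bij_betw_def m_def dest: inj_onD)
  have surj: "e ` {..<m} = V"
    using e by (simp add: bij_betw_def m_def)
  \<comment> \<open>Complete independence of the process is stated for infinite sequences of
    disjoint sets, hence the padding by empty sets.\<close>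
  define A where "A j = (if j < m then F -` {e j} else {})" for j
  have A [measurable]: "A j \<in> sets borel" for j
    unfolding A_def using measurable_sets_borel[of F borel "{e j}"] by simp
  have disj: "disjoint_family A"
    using inj by (auto simp: disjoint_family_on_def A_def split: if_splits)
  \<comment> \<open>Used for the identity, to split the sum over points, and for 1 - exp(-v), to
    reassemble the integral. Points outside all level sets force the condition
    \<open>g 0 = 0\<close>.\<close>
  have rep: "g (F x) = (\<Sum>j<m. g (e j) * indicator (A j) x)" if "g 0 = 0" for g :: "ennreal \<Rightarrow> ennreal" and x
  proof (cases "F x = 0")
    case True
    have "x \<notin> A j" for j
      using surj True by (auto simp: A_def V_def split: if_splits)
    then show ?thesis using that True by simp
  next
    case False
    then have "F x \<in> e ` {..<m}" unfolding surj by (simp add: V_def)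
    then obtain k where k: "k < m" "F x = e k" by auto
    have "indicator (A j) x = (if j = k then 1 else 0 :: ennreal)" if "j < m" for j
      using that k inj[of j k] by (auto simp: A_def indicator_def)
    then have "(\<Sum>j<m. g (e j) * indicator (A j) x) = (\<Sum>j<m. if j = k then g (e j) else 0)"
      by (intro sum.cong) auto
    then show ?thesis using k by simp
  qed
  have fin: "emeasure \<Lambda> (A j) < \<infinity>" for j
  proof -
    have "A j \<subseteq> {x. F x \<noteq> 0}"
      using surj by (auto simp: A_def V_def split: if_splits)
    then have "emeasure \<Lambda> (A j) \<le> emeasure \<Lambda> {x. F x \<noteq> 0}"
      by (intro emeasure_mono) auto
    then show ?thesis using F(3) by simp
  qed
  have efin: "e j \<noteq> \<top>" if "j < m" for j
  proof -
    have "e j \<in> V" using that surj by auto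
    then obtain x where "e j = F x" by (auto simp: V_def)
    then show ?thesis using F(2)[of x] by simp
  qed
  have "F = (\<lambda>x. \<Sum>j<m. e j * indicator (A j) x)"
    using rep[of "\<lambda>v. v"] by auto
  then have sp: "sum_points (\<lambda>_. F) \<phi> = (\<Sum>j<m. e j * count_in (A j) \<phi>)" for \<phi>
    by (simp only: sum_points_sum sum_points_cmult count_in_eq_sum_points)
  have "indep_vars (\<lambda>_. borel) (\<lambda>j \<omega>. count_in (A j) (\<Phi> \<omega>)) UNIV"
    using P A disj unfolding poisson_point_process_def by blast
  then have "indep_vars (\<lambda>_. borel) (\<lambda>j \<omega>. count_in (A j) (\<Phi> \<omega>)) {..<m}"
    by (rule indep_vars_subset) simp
  then have ind: "indep_vars (\<lambda>_. borel) (\<lambda>j \<omega>. ennreal (exp_neg (e j * count_in (A j) (\<Phi> \<omega>)))) {..<m}"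
    by (rule indep_vars_compose2) measurable
  have "(\<integral>\<^sup>+\<omega>. ennreal (exp_neg (sum_points (\<lambda>_. F) (\<Phi> \<omega>))) \<partial>M) =
      (\<integral>\<^sup>+\<omega>. (\<Prod>j<m. ennreal (exp_neg (e j * count_in (A j) (\<Phi> \<omega>)))) \<partial>M)"
    by (simp add: sp exp_neg_sum prod_ennreal)
  also have "\<dots> = (\<Prod>j<m. \<integral>\<^sup>+\<omega>. ennreal (exp_neg (e j * count_in (A j) (\<Phi> \<omega>))) \<partial>M)"
    by (rule indep_vars_nn_integral[OF _ ind]) auto
  also have "\<dots> = (\<Prod>j<m. ennreal (exp_neg (ennreal (1 - exp_neg (e j)) * emeasure \<Lambda> (A j))))"
    using fin efin by (intro prod.cong refl poisson_count_laplace[OF M P]) auto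
  also have "\<dots> = ennreal (exp_neg (\<Sum>j<m. ennreal (1 - exp_neg (e j)) * emeasure \<Lambda> (A j)))"
    by (simp add: exp_neg_sum prod_ennreal)
  also have "(\<Sum>j<m. ennreal (1 - exp_neg (e j)) * emeasure \<Lambda> (A j)) =
      (\<integral>\<^sup>+x. (\<Sum>j<m. ennreal (1 - exp_neg (e j)) * indicator (A j) x) \<partial>\<Lambda>)"
    by (subst nn_integral_sum) (auto simp: nn_integral_cmult_indicator)
  also have "\<dots> = (\<integral>\<^sup>+x. ennreal (1 - exp_neg (F x)) \<partial>\<Lambda>)"
    using rep[of "\<lambda>v. ennreal (1 - exp_neg v)"] by simp
  finally show ?thesis .
qed

text \<open>Approximation from below by finite simple weights. The left side passes to the limit by
  bounded convergence, the exponent on the right by monotone convergence; both use continuity of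
  \<open>exp_neg\<close>, since F may take the value \<top>.\<close>

lemma poisson_laplace_functional:
  assumes M: "prob_space M" and P: "poisson_point_process M \<Lambda> \<Phi>"
    and \<Lambda>: "sets \<Lambda> = sets borel" "sigma_finite_measure \<Lambda>"
    and F [measurable]: "F \<in> borel_measurable borel"
  shows "(\<integral>\<^sup>+\<omega>. ennreal (exp_neg (sum_points (\<lambda>_. F) (\<Phi> \<omega>))) \<partial>M) =
    ennreal (exp_neg (\<integral>\<^sup>+x. ennreal (1 - exp_neg (F x)) \<partial>\<Lambda>))"
proof -
  interpret prob_space M by fact
  interpret \<Lambda>: sigma_finite_measure \<Lambda> by fact
  note [measurable_cong] = \<Lambda>(1)
  have \<Phi> [measurable]: "\<Phi> \<in> measurable M configurations"
    using P by (simp add: poisson_point_process_def)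
  have space\<Lambda>: "space \<Lambda> = UNIV" using sets_eq_imp_space_eq[OF \<Lambda>(1)] by simp
  obtain B where B: "range B \<subseteq> sets \<Lambda>" "(\<Union>i. B i) = space \<Lambda>" "\<And>i. emeasure \<Lambda> (B i) \<noteq> \<infinity>" "incseq B"
    using \<Lambda>.sigma_finite_incseq by metis
  then have Bm [measurable]: "B i \<in> sets borel" for i using \<Lambda>(1) by auto
  obtain U where U: "\<And>i. simple_function borel (U i)" "incseq U" "\<And>i x. U i x < top" "\<And>x. (SUP i. U i x) = F x"
    using borel_measurable_implies_simple_function_sequence'[OF F] by metis
  \<comment> \<open>A simple function may be nonzero on a set of infinite intensity; cutting it off
    at an exhausting sequence of finite intensity meets the hypotheses of the simple case without
    changing the limit.\<close>
  define G where "G i x = U i x * indicator (B i) x" for i x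
  have G1: "simple_function borel (G i)" for i
    unfolding G_def by (intro simple_function_mult U(1) simple_function_indicator) (use Bm in auto)
  have G2: "G i x \<noteq> \<top>" for i x
    using U(3)[of i x] by (auto simp: G_def indicator_def)
  have G3: "emeasure \<Lambda> {x. G i x \<noteq> 0} < \<infinity>" for i
  proof -
    have "emeasure \<Lambda> {x. G i x \<noteq> 0} \<le> emeasure \<Lambda> (B i)"
      by (intro emeasure_mono) (auto simp: G_def indicator_def \<Lambda>(1))
    then show ?thesis using B(3)[of i] by (auto simp: less_top order_le_less_trans)
  qed
  have incG: "incseq (\<lambda>i. G i x)" for x
    unfolding G_def incseq_def
    using U(2) B(4) by (auto simp: incseq_def le_fun_def intro!: mult_mono split: split_indicator) blast+
  have limG: "(\<lambda>i. G i x) \<longlonglongrightarrow> F x" for x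
  proof -
    have "(\<lambda>i. U i x) \<longlonglongrightarrow> F x"
      using LIMSEQ_SUP[of "\<lambda>i. U i x"] U(2,4) by (auto simp: incseq_def le_fun_def)
    moreover obtain k where k: "x \<in> B k" using B(2) space\<Lambda> by auto
    have "\<forall>\<^sub>F i in sequentially. U i x = G i x"
      using eventually_ge_at_top[of k]
      by eventually_elim (use B(4) k in \<open>auto simp: G_def incseq_def subset_iff\<close>)
    ultimately show ?thesis by (rule Lim_transform_eventually)
  qed
  have [measurable]: "G i \<in> borel_measurable borel" for i
    using G1 by (rule borel_measurable_simple_function)
  have "(\<lambda>i. sum_points (\<lambda>_. G i) \<phi>) \<longlonglongrightarrow> sum_points (\<lambda>_. F) \<phi>" for \<phi>
    unfolding sum_points_def nn_integral_count_space_nat[symmetric]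
  proof (rule nn_integral_LIMSEQ)
    show "incseq (\<lambda>n i. if enat i < fst \<phi> then G n (snd \<phi> i) else 0)"
      using incG by (auto simp: incseq_def le_fun_def)
  qed (use limG in auto)
  then have sp: "(\<lambda>i. exp_neg (sum_points (\<lambda>_. G i) \<phi>)) \<longlonglongrightarrow> exp_neg (sum_points (\<lambda>_. F) \<phi>)" for \<phi>
    by (rule tendsto_exp_neg)
  have spm [measurable]: "sum_points (\<lambda>_. G i) \<in> borel_measurable configurations" for i
    by (rule measurable_sum_points) simp
  have "(\<lambda>i. \<integral>\<^sup>+\<omega>. ennreal (exp_neg (sum_points (\<lambda>_. G i) (\<Phi> \<omega>))) \<partial>M)
      \<longlonglongrightarrow> (\<integral>\<^sup>+\<omega>. ennreal (exp_neg (sum_points (\<lambda>_. F) (\<Phi> \<omega>))) \<partial>M)"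
    by (rule nn_integral_bounded_convergence) (use sp in auto)
  moreover have "(\<lambda>i. \<integral>\<^sup>+x. ennreal (1 - exp_neg (G i x)) \<partial>\<Lambda>) \<longlonglongrightarrow> (\<integral>\<^sup>+x. ennreal (1 - exp_neg (F x)) \<partial>\<Lambda>)"
  proof (rule nn_integral_LIMSEQ)
    show "incseq (\<lambda>i x. ennreal (1 - exp_neg (G i x)))"
      using incG by (auto simp: incseq_def le_fun_def intro!: ennreal_leI exp_neg_antimono)
    show "(\<lambda>i. ennreal (1 - exp_neg (G i x))) \<longlonglongrightarrow> ennreal (1 - exp_neg (F x))" for x
      by (intro tendsto_ennrealI tendsto_diff tendsto_const tendsto_exp_neg limG)
  qed simp
  then have "(\<lambda>i. ennreal (exp_neg (\<integral>\<^sup>+x. ennreal (1 - exp_neg (G i x)) \<partial>\<Lambda>)))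
      \<longlonglongrightarrow> ennreal (exp_neg (\<integral>\<^sup>+x. ennreal (1 - exp_neg (F x)) \<partial>\<Lambda>))"
    by (intro tendsto_ennrealI tendsto_exp_neg)
  then have "(\<lambda>i. \<integral>\<^sup>+\<omega>. ennreal (exp_neg (sum_points (\<lambda>_. G i) (\<Phi> \<omega>))) \<partial>M)
      \<longlonglongrightarrow> ennreal (exp_neg (\<integral>\<^sup>+x. ennreal (1 - exp_neg (F x)) \<partial>\<Lambda>))"
    by (simp add: poisson_laplace_functional_simple[OF M P \<Lambda>(1) G1 G2 G3])
  ultimately show ?thesis by (rule LIMSEQ_unique)
qed

text \<open>
  Conditioning on the points first turns independent marks into a deterministic weight
  \<open>E (exp (- f (x, H)))\<close> per point, to which the unmarked Laplace functional applies.
\<close>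

lemma marked_ppp_laplace_functional:
  fixes M :: "'w measure" and D :: "'a measure" and f :: "(real^2) \<times> 'a \<Rightarrow> ennreal"
  assumes M: "prob_space M" and P: "iid_marked_ppp M \<Lambda> D \<Phi> H"
    and \<Lambda>: "sets \<Lambda> = sets borel" "sigma_finite_measure \<Lambda>"
    and f [measurable]: "f \<in> borel_measurable (borel \<Otimes>\<^sub>M D)"
  shows "(\<integral>\<^sup>+\<omega>. ennreal (exp_neg (sum_points (\<lambda>i x. f (x, H i \<omega>)) (\<Phi> \<omega>))) \<partial>M) =
    ennreal (exp_neg (\<integral>\<^sup>+x. (1 - (\<integral>\<^sup>+h. ennreal (exp_neg (f (x, h))) \<partial>D)) \<partial>\<Lambda>))"
proof -
  interpret prob_space M by fact
  have ppp: "poisson_point_process M \<Lambda> \<Phi>" and iid: "iid_with_law M D H"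
    and ind: "indep_sets (case_option (generated_events M configurations \<Phi>) (\<lambda>i. generated_events M D (H i))) UNIV"
    using P by (auto simp: iid_marked_ppp_def)
  have \<Phi> [measurable]: "\<Phi> \<in> measurable M configurations"
    using ppp by (simp add: poisson_point_process_def)
  have H: "indep_vars (\<lambda>_. D) H UNIV" and D: "distr M D (H i) = D" for i
    using iid by (auto simp: iid_with_law_def)
  then have Hm [measurable]: "H i \<in> measurable M D" for i
    by (auto simp: indep_vars_def)
  interpret D: prob_space D
    using prob_space_distr[OF Hm[of 0]] D by metis
  define S where "S i = sigma (space M) (case_option (generated_events M configurations \<Phi>) (\<lambda>i. generated_events M D (H i)) i)"
    for i :: "nat option"
  have S: "indep_vars S (\<lambda>_ \<omega>. \<omega>) UNIV"
    unfolding S_def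
    by (rule indep_sets_imp_indep_vars_identity[OF ind])
      (auto split: option.split simp: generated_events_Int_stable)
  have \<Phi>S [measurable]: "\<Phi> \<in> measurable (S None) configurations"
    unfolding S_def using measurable_space[OF \<Phi>] by (auto intro!: measurable_generated_events)
  have HS [measurable]: "H i \<in> measurable (S (Some i)) D" for i
    unfolding S_def using measurable_space[OF Hm] by (auto intro!: measurable_generated_events)
  \<comment> \<open>u supplies the points and v the marks. With all coordinates equal to \<omega>
    this is the original integrand; after the split the marks are averaged while the configuration
    is held fixed.\<close>
  let ?G = "\<lambda>(u :: nat option \<Rightarrow> 'w, v :: nat option \<Rightarrow> 'w). ennreal (exp_neg (sum_points (\<lambda>i x. f (x, H i (v (Some i)))) (\<Phi> (u None))))"
  have "(\<integral>\<^sup>+\<omega>. ?G (restrict (\<lambda>_. \<omega>) {None}, restrict (\<lambda>_. \<omega>) (range Some)) \<partial>M) =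
    (\<integral>\<^sup>+\<omega>. \<integral>\<^sup>+\<omega>'. ?G (restrict (\<lambda>_. \<omega>) {None}, restrict (\<lambda>_. \<omega>') (range Some)) \<partial>M \<partial>M)"
  proof (rule indep_vars_nn_integral_split[OF S, where J="{None}" and K="range Some" and G="?G"])
    have "(\<lambda>z. sum_points (\<lambda>i x. f (x, H i (snd z (Some i)))) (\<Phi> (fst z None)))
        \<in> borel_measurable (PiM {None} S \<Otimes>\<^sub>M PiM (range Some) S)"
      by (rule measurable_sum_points_marked[where D=D]) measurable
    then show "?G \<in> borel_measurable (PiM {None} S \<Otimes>\<^sub>M PiM (range Some) S)"
      unfolding split_beta' by measurable
  qed auto
  then have split: "(\<integral>\<^sup>+\<omega>. ennreal (exp_neg (sum_points (\<lambda>i x. f (x, H i \<omega>)) (\<Phi> \<omega>))) \<partial>M) =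
      (\<integral>\<^sup>+\<omega>. \<integral>\<^sup>+\<omega>'. ennreal (exp_neg (sum_points (\<lambda>i x. f (x, H i \<omega>')) (\<Phi> \<omega>))) \<partial>M \<partial>M)"
    by simp
  define g where "g x = (\<integral>\<^sup>+h. ennreal (exp_neg (f (x, h))) \<partial>D)" for x
  have g [measurable]: "g \<in> borel_measurable borel" unfolding g_def by measurable
  have g1: "g x \<le> 1" for x
  proof -
    have "g x \<le> (\<integral>\<^sup>+h. 1 \<partial>D)" unfolding g_def by (intro nn_integral_mono) (simp add: ennreal_le_1)
    then show ?thesis by (simp add: D.emeasure_space_1)
  qed
  \<comment> \<open>The deterministic weight whose transform equals the averaged factor g; it is
    \<top> where that factor vanishes.\<close>
  define F where "F x = (if g x = 0 then \<top> else ennreal (- ln (enn2real (g x))))" for x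
  have [measurable]: "F \<in> borel_measurable borel" unfolding F_def by measurable
  have Fg: "ennreal (exp_neg (F x)) = g x" for x
  proof (cases "g x = 0")
    case False
    then obtain r where r: "g x = ennreal r" "0 < r" "r \<le> 1"
      using g1[of x] by (cases "g x") (auto simp: ennreal_le_1 top_unique less_le)
    then show ?thesis by (simp add: F_def exp_neg_ennreal)
  qed (simp add: F_def)
  have inner: "(\<integral>\<^sup>+\<omega>'. ennreal (exp_neg (sum_points (\<lambda>i x. f (x, H i \<omega>')) \<phi>)) \<partial>M) =
      ennreal (exp_neg (sum_points (\<lambda>_. F) \<phi>))" for \<phi>
  proof -
    \<comment> \<open>Indices beyond the number of points get weight 0 and contribute the factor 1,
      so a finite configuration can be treated as an infinite product.\<close>
    define w where "w i h = (if enat i < fst \<phi> then f (snd \<phi> i, h) else 0)" for i h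
    have [measurable]: "w i \<in> borel_measurable D" for i unfolding w_def by measurable
    have "(\<lambda>N. \<integral>\<^sup>+\<omega>'. ennreal (\<Prod>i<N. exp_neg (w i (H i \<omega>'))) \<partial>M)
        \<longlonglongrightarrow> (\<integral>\<^sup>+\<omega>'. ennreal (exp_neg (\<Sum>i. w i (H i \<omega>'))) \<partial>M)"
      by (rule nn_integral_bounded_convergence)
        (auto intro!: exp_neg_suminf prod_nonneg prod_le_1)
    moreover have "(\<integral>\<^sup>+\<omega>'. ennreal (\<Prod>i<N. exp_neg (w i (H i \<omega>'))) \<partial>M) =
        ennreal (\<Prod>i<N. exp_neg (if enat i < fst \<phi> then F (snd \<phi> i) else 0))" for N
    proof -
      have "indep_vars (\<lambda>_. borel) (\<lambda>i \<omega>. ennreal (exp_neg (w i (H i \<omega>)))) {..<N}"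
        by (rule indep_vars_compose2[OF indep_vars_subset[OF H]]) auto
      then have "(\<integral>\<^sup>+\<omega>'. (\<Prod>i<N. ennreal (exp_neg (w i (H i \<omega>')))) \<partial>M) =
          (\<Prod>i<N. \<integral>\<^sup>+\<omega>'. ennreal (exp_neg (w i (H i \<omega>'))) \<partial>M)"
        by (intro indep_vars_nn_integral) auto
      also have "\<dots> = (\<Prod>i<N. ennreal (exp_neg (if enat i < fst \<phi> then F (snd \<phi> i) else 0)))"
      proof (intro prod.cong refl)
        fix i
        have "(\<integral>\<^sup>+\<omega>'. ennreal (exp_neg (w i (H i \<omega>'))) \<partial>M) = (\<integral>\<^sup>+h. ennreal (exp_neg (w i h)) \<partial>distr M D (H i))"
          by (rule nn_integral_distr[symmetric]) auto
        also have "\<dots> = ennreal (exp_neg (if enat i < fst \<phi> then F (snd \<phi> i) else 0))"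
          by (simp add: D w_def Fg) (simp add: g_def D.emeasure_space_1)
        finally show "(\<integral>\<^sup>+\<omega>'. ennreal (exp_neg (w i (H i \<omega>'))) \<partial>M) =
          ennreal (exp_neg (if enat i < fst \<phi> then F (snd \<phi> i) else 0))" .
      qed
      finally show ?thesis by (simp add: prod_ennreal)
    qed
    moreover have "(\<lambda>N. ennreal (\<Prod>i<N. exp_neg (if enat i < fst \<phi> then F (snd \<phi> i) else 0)))
        \<longlonglongrightarrow> ennreal (exp_neg (\<Sum>i. if enat i < fst \<phi> then F (snd \<phi> i) else 0))"
      by (intro tendsto_ennrealI exp_neg_suminf)
    ultimately have "(\<integral>\<^sup>+\<omega>'. ennreal (exp_neg (\<Sum>i. w i (H i \<omega>'))) \<partial>M) =
        ennreal (exp_neg (\<Sum>i. if enat i < fst \<phi> then F (snd \<phi> i) else 0))"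
      by (simp only:) (rule LIMSEQ_unique)
    then show ?thesis
      by (simp add: sum_points_def w_def)
  qed
  have "ennreal (1 - exp_neg (F x)) = 1 - g x" for x
    using ennreal_minus[of "exp_neg (F x)" 1] by (simp add: Fg)
  then show ?thesis
    unfolding split inner
    by (simp add: poisson_laplace_functional[OF M ppp \<Lambda>] g_def)
qed

section \<open>Laplace transforms of the marks\<close>

lemma sets_exponential_law [measurable_cong]: "sets (exponential_law \<mu>) = sets borel"
  by (simp add: exponential_law_def)

lemma sets_unit_mean_gamma_law [measurable_cong]: "sets (unit_mean_gamma_law m) = sets borel"
  by (simp add: unit_mean_gamma_law_def)

text \<open>Exponential tilting: multiplying the density of rate 1 / \<mu> by exp(- c * h) gives 1 /
  (1 + c * \<mu>) times the density of rate l = 1 / \<mu> + c, whose total mass is 1.\<close>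

lemma exponential_law_laplace:
  assumes "0 < \<mu>" "0 \<le> c"
  shows "(\<integral>\<^sup>+h. ennreal (exp_neg (ennreal (c * h))) \<partial>exponential_law \<mu>) = ennreal (1 / (1 + c * \<mu>))"
proof -
  define l where "l = 1 / \<mu> + c"
  have l: "0 < l" using assms by (simp add: l_def add_pos_nonneg)
  interpret E: prob_space "density lborel (exponential_density l)"
    by (rule prob_space_exponential_density[OF l])
  have E: "(\<integral>\<^sup>+h. ennreal (exponential_density l h) \<partial>lborel) = 1"
    using E.emeasure_space_1 by (simp add: emeasure_density)
  have eq: "exponential_density (1 / \<mu>) h * exp_neg (ennreal (c * h)) = 1 / (1 + c * \<mu>) * exponential_density l h" for h
  proof (cases "h < 0")
    case False
    have "exponential_density (1 / \<mu>) h * exp_neg (ennreal (c * h)) = 1 / \<mu> * (exp (- (h / \<mu>)) * exp (- (c * h)))"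
      using False assms by (simp add: exponential_density_def exp_neg_ennreal)
    also have "exp (- (h / \<mu>)) * exp (- (c * h)) = exp (- (h * l))"
      by (simp add: l_def exp_add[symmetric] algebra_simps)
    also have "1 / \<mu> * exp (- (h * l)) = 1 / (1 + c * \<mu>) * l * exp (- (h * l))"
    proof -
      have "l = (1 + c * \<mu>) / \<mu>" using assms by (simp add: l_def field_simps)
      moreover have "0 < 1 + c * \<mu>" using assms by (simp add: add_pos_nonneg)
      ultimately show ?thesis by simp
    qed
    finally show ?thesis
      using False by (simp add: exponential_density_def)
  qed (simp add: exponential_density_def)
  have "(\<integral>\<^sup>+h. ennreal (exp_neg (ennreal (c * h))) \<partial>exponential_law \<mu>) =
      (\<integral>\<^sup>+h. ennreal (1 / (1 + c * \<mu>)) * ennreal (exponential_density l h) \<partial>lborel)"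
    unfolding exponential_law_def
    using assms l by (subst nn_integral_density)
      (auto intro!: nn_integral_cong simp: ennreal_mult[symmetric] eq exponential_density_nonneg)
  also have "\<dots> = ennreal (1 / (1 + c * \<mu>))"
    by (subst nn_integral_cmult) (auto simp: E)
  finally show ?thesis .
qed

text \<open>The substitution t = (m + c) * h turns the tilted density into the integrand of the
  Gamma function. The factor m^m / (m + c)^m that remains is the claimed value.\<close>

lemma unit_mean_gamma_law_laplace:
  assumes m: "0 < m" and c: "0 \<le> c"
  shows "(\<integral>\<^sup>+h. ennreal (exp_neg (ennreal (c * h))) \<partial>unit_mean_gamma_law m) = ennreal ((1 + c / m) powr (- m))"
proof -
  define l where "l = m + c"
  have l: "0 < l" using assms by (simp add: l_def)
  define k where "k = (1 + c / m) powr (- m) / Gamma m"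
  have G: "0 < Gamma m" using m by (rule Gamma_real_pos)
  have k: "0 \<le> k" using G by (simp add: k_def)
  \<comment> \<open>The integrand in the form of \<open>Gamma_conv_nn_integral_real\<close>; it
    appears below as \<open>w (0 + l * h)\<close> to match the affine substitution rule.\<close>
  define w where "w t = indicator {0..} t * t powr (m - 1) / exp t" for t :: real
  have ml: "m powr m / l powr m = (1 + c / m) powr (- m)"
  proof -
    have "1 + c / m = l / m" using m by (simp add: l_def field_simps)
    then show ?thesis using m l by (simp add: powr_divide powr_minus field_simps)
  qed
  have eq: "(if 0 < h then m powr m * h powr (m - 1) * exp (- m * h) / Gamma m else 0) * exp_neg (ennreal (c * h))
      = k * l * w (0 + l * h)" for h
  proof (cases "0 < h")
    case True
    have "exp (- (m * h)) * exp (- (c * h)) = 1 / exp (l * h)"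
      by (simp add: l_def exp_add[symmetric] exp_minus[symmetric] inverse_eq_divide[symmetric] algebra_simps)
    moreover have "m powr m * h powr (m - 1) = (1 + c / m) powr (- m) * l * (l * h) powr (m - 1)"
      using True l by (simp add: ml[symmetric] powr_mult powr_diff)
    ultimately have "m powr m * h powr (m - 1) * (exp (- (m * h)) * exp (- (c * h)))
      = (1 + c / m) powr (- m) * l * (l * h) powr (m - 1) * (1 / exp (l * h))"
      by simp
    then show ?thesis
      using True l c G by (simp add: exp_neg_ennreal k_def w_def field_simps)
  next
    case False
    then have "w (l * h) = 0"
      using l by (auto simp: w_def indicator_def zero_le_mult_iff)
    then show ?thesis using False by simp
  qed
  have [measurable]: "w \<in> borel_measurable borel" unfolding w_def by measurable
  have w: "0 \<le> w t" for t by (simp add: w_def)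
  have "(\<integral>\<^sup>+h. ennreal (exp_neg (ennreal (c * h))) \<partial>unit_mean_gamma_law m) =
      (\<integral>\<^sup>+h. ennreal k * (ennreal l * ennreal (w (0 + l * h))) \<partial>lborel)"
    unfolding unit_mean_gamma_law_def
    using l k w by (subst nn_integral_density)
      (auto intro!: nn_integral_cong simp: ennreal_mult''[symmetric] ennreal_mult[symmetric] eq[simplified] mult.assoc G less_imp_le)
  also have "\<dots> = ennreal k * (ennreal \<bar>l\<bar> * (\<integral>\<^sup>+h. ennreal (w (0 + l * h)) \<partial>lborel))"
    using l by (simp add: nn_integral_cmult)
  also have "\<dots> = ennreal k * (\<integral>\<^sup>+t. ennreal (w t) \<partial>lborel)"
    using l by (subst nn_integral_real_affine[of "\<lambda>t. ennreal (w t)" l 0, symmetric]) auto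
  also have "(\<integral>\<^sup>+t. ennreal (w t) \<partial>lborel) = ennreal (Gamma m)"
    unfolding w_def by (rule Gamma_conv_nn_integral_real[OF m, symmetric])
  also have "ennreal k * ennreal (Gamma m) = ennreal ((1 + c / m) powr (- m))"
    using k G by (simp add: ennreal_mult[symmetric] k_def)
  finally show ?thesis .
qed

section \<open>Shot noise of the model\<close>

text \<open>The common shape of all four interference sums: the averaged factor of a point depends
  on its distance only. The intensity is split into a constant k and a profile q as in the final
  formulas. Conditions on q are restricted to distances beyond R because
  \<open>1 - p_LOS p y\<close> is negative for negative y.\<close>

lemma radial_marked_ppp_laplace:
  fixes f :: "(real^2) \<times> 'a \<Rightarrow> ennreal"
  assumes M: "prob_space M" and P: "iid_marked_ppp M (exterior_intensity R g) D \<Phi> H"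
    and f: "f \<in> borel_measurable (borel \<Otimes>\<^sub>M D)"
    and g [measurable]: "g \<in> borel_measurable borel" and R: "0 \<le> R"
    and gq: "\<And>y. R \<le> y \<Longrightarrow> g y = k * q y" "0 \<le> k" "\<And>y. R \<le> y \<Longrightarrow> 0 \<le> q y"
    and q [measurable]: "q \<in> borel_measurable borel"
    and \<psi> [measurable]: "\<psi> \<in> borel_measurable borel" and \<psi>01: "\<And>y. 0 \<le> y \<Longrightarrow> 0 \<le> \<psi> y \<and> \<psi> y \<le> 1"
    and f\<psi>: "\<And>x. (\<integral>\<^sup>+h. ennreal (exp_neg (f (x, h))) \<partial>D) = ennreal (\<psi> (norm x))"
  shows "(\<integral>\<^sup>+\<omega>. ennreal (exp_neg (sum_points (\<lambda>i x. f (x, H i \<omega>)) (\<Phi> \<omega>))) \<partial>M) =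
    ennreal (exp_neg (ennreal (2 * pi * k) * (\<integral>\<^sup>+y\<in>{R..}. ennreal (q y * (1 - \<psi> y) * y) \<partial>lborel)))"
proof -
  have "(\<integral>\<^sup>+x. (1 - (\<integral>\<^sup>+h. ennreal (exp_neg (f (x, h))) \<partial>D)) \<partial>exterior_intensity R g) =
      (\<integral>\<^sup>+x. (\<lambda>y. ennreal (1 - \<psi> y)) (norm x) \<partial>exterior_intensity R g)"
    using \<psi>01 by (intro nn_integral_cong) (simp add: f\<psi> ennreal_minus flip: ennreal_1)
  also have "\<dots> = (\<integral>\<^sup>+y\<in>{R..}. ennreal (2 * pi * y) * ennreal (g y) * ennreal (1 - \<psi> y) \<partial>lborel)"
    using R by (intro nn_integral_exterior_intensity) auto
  also have "\<dots> = (\<integral>\<^sup>+y. ennreal (2 * pi * k) * (ennreal (q y * (1 - \<psi> y) * y) * indicator {R..} y) \<partial>lborel)"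
    using R gq \<psi>01 by (intro nn_integral_cong) (auto split: split_indicator simp: ennreal_mult[symmetric] mult_ac)
  also have "\<dots> = ennreal (2 * pi * k) * (\<integral>\<^sup>+y\<in>{R..}. ennreal (q y * (1 - \<psi> y) * y) \<partial>lborel)"
    by (rule nn_integral_cmult) simp
  finally show ?thesis
    using marked_ppp_laplace_functional[OF M P sets_exterior_intensity sigma_finite_exterior_intensity[OF g] f]
    by simp
qed

text \<open>A scatterer outside the cell has weight 0, so one minus the averaged factor is a
  constant on the cell and 0 elsewhere; its integral is that constant times the expected number of
  scatterers in the cell.\<close>

lemma S_b_laplace:
  assumes Q: "prob_space Q" and C: "intra_clutter_model p X Q" and p: "valid_radar p"
    and A [measurable]: "A_rb r b \<in> sets borel" and a: "emeasure lborel (A_rb r b) = ennreal a" "0 \<le> a"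
    and AE: "AE \<omega> in Q. (R_n X \<omega>, beta X \<omega>) = (r, b)" and s: "0 \<le> s"
  shows "(\<integral>\<^sup>+\<omega>. ennreal (exp_neg (ennreal s * S_b A_rb X \<omega>)) \<partial>Q) =
    ennreal (exp (- lam_cl p * a * (s * sig_cl p / (1 + s * sig_cl p))))"
proof -
  have pos: "0 < lam_cl p" "0 < sig_cl p" using p by (auto simp: valid_radar_def)
  let ?f = "\<lambda>(x, h). ennreal s * (ennreal h * indicator (A_rb r b) x)"
  let ?\<Lambda> = "density lborel (\<lambda>_. ennreal (lam_cl p)) :: (real^2) measure"
  define k where "k = s * sig_cl p / (1 + s * sig_cl p)"
  have z: "0 < 1 + s * sig_cl p" using pos s by (simp add: add_pos_nonneg)
  then have k: "0 \<le> k" "1 - 1 / (1 + s * sig_cl p) = k"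
    using pos s by (simp_all add: k_def diff_divide_eq_iff)
  have "(\<integral>\<^sup>+\<omega>. ennreal (exp_neg (ennreal s * S_b A_rb X \<omega>)) \<partial>Q) =
      (\<integral>\<^sup>+\<omega>. ennreal (exp_neg (sum_points (\<lambda>i x. ?f (x, sigma_c X i \<omega>)) (Phi_cl X \<omega>))) \<partial>Q)"
  proof (rule nn_integral_cong_AE)
    \<comment> \<open>The cell in \<open>S_b\<close> is random through \<open>R_n\<close> and
      \<open>beta\<close>; under Q it is almost surely the fixed cell
      \<open>A_rb r b\<close>.\<close>
    show "AE \<omega> in Q. ennreal (exp_neg (ennreal s * S_b A_rb X \<omega>)) =
        ennreal (exp_neg (sum_points (\<lambda>i x. ?f (x, sigma_c X i \<omega>)) (Phi_cl X \<omega>)))"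
      using AE by eventually_elim (simp add: S_b_def sum_points_cmult)
  qed
  also have "\<dots> = ennreal (exp_neg (\<integral>\<^sup>+x. (1 - (\<integral>\<^sup>+h. ennreal (exp_neg (?f (x, h))) \<partial>exponential_law (sig_cl p))) \<partial>?\<Lambda>))"
  proof (rule marked_ppp_laplace_functional[OF Q])
    show "iid_marked_ppp Q ?\<Lambda> (exponential_law (sig_cl p)) (Phi_cl X) (sigma_c X)"
      using C by (simp add: intra_clutter_model_def)
    show "sigma_finite_measure ?\<Lambda>"
      by (subst sigma_finite_measure.sigma_finite_iff_density_finite[OF sigma_finite_lborel]) auto
  qed simp_all
  also have "(\<lambda>x. 1 - (\<integral>\<^sup>+h. ennreal (exp_neg (?f (x, h))) \<partial>exponential_law (sig_cl p))) =
      (\<lambda>x. ennreal k * indicator (A_rb r b) x)"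
  proof
    fix x
    interpret E: prob_space "exponential_law (sig_cl p)"
      unfolding exponential_law_def using pos by (intro prob_space_exponential_density) simp
    have "1 - ennreal (1 / (1 + s * sig_cl p)) = ennreal k"
      using pos s by (simp add: k(2)[symmetric] ennreal_minus flip: ennreal_1)
    then show "1 - (\<integral>\<^sup>+h. ennreal (exp_neg (?f (x, h))) \<partial>exponential_law (sig_cl p)) = ennreal k * indicator (A_rb r b) x"
      using exponential_law_laplace[OF pos(2) s] s E.emeasure_space_1
      by (auto split: split_indicator simp: ennreal_mult'[symmetric])
  qed
  also have "(\<integral>\<^sup>+x. ennreal k * indicator (A_rb r b) x \<partial>?\<Lambda>) = ennreal k * (ennreal (lam_cl p) * ennreal a)"
    by (subst nn_integral_cmult_indicator)
      (auto simp: emeasure_density nn_integral_cmult_indicator a)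
  also have "\<dots> = ennreal (k * (lam_cl p * a))"
    using k(1) pos a(2) by (simp add: ennreal_mult)
  also have "exp_neg \<dots> = exp (- lam_cl p * a * k)"
    using k(1) pos a(2) by (subst exp_neg_ennreal) (simp_all add: mult_ac)
  also have "k = s * sig_cl p / (1 + s * sig_cl p)" by (rule k_def)
  finally show ?thesis .
qed

lemma cos_half_nonneg: "0 \<le> t \<Longrightarrow> t \<le> pi \<Longrightarrow> 0 \<le> cos (t / 2)"
  by (rule cos_ge_zero) auto

lemma p_LOS_measurable [measurable]: "p_LOS p \<in> borel_measurable borel"
  unfolding p_LOS_def[abs_def] by measurable

lemma I_IC1_laplace:
  assumes M: "prob_space M" and p: "valid_radar p"
    and P: "iid_marked_ppp M (exterior_intensity R (\<lambda>r. p_LOS p r * lam_BS p / real (n_freq p)))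
      (exponential_law (sig_t p)) (Phi_IC1 X) (sigma_v X)"
    and AE: "AE \<omega> in M. beta_I X \<omega> = t" and R: "0 \<le> R" and t: "0 \<le> t" "t \<le> pi" and s: "0 \<le> s"
  shows "(\<integral>\<^sup>+\<omega>. ennreal (exp_neg (ennreal s * I_IC1 p X \<omega>)) \<partial>M) =
    ennreal (exp_neg (ennreal (2 * pi * lam_BS p / real (n_freq p)) *
      (\<integral>\<^sup>+y\<in>{R..}. ennreal (p_LOS p y *
         (1 - 1 / (1 + s * cos (t / 2) * y powr (- eta_L p) * sig_t p)) * y) \<partial>lborel)))"
proof -
  have pos: "0 < lam_BS p" "0 < sig_t p" "0 < n_freq p" using p by (auto simp: valid_radar_def)
  let ?f = "\<lambda>(x :: real^2, h). ennreal s * ennreal (cos (t / 2) * norm x powr (- eta_L p) * h)"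
  let ?\<psi> = "\<lambda>y. 1 / (1 + s * cos (t / 2) * y powr (- eta_L p) * sig_t p)"
  have c: "0 \<le> s * cos (t / 2) * y powr (- eta_L p)" for y
    using s cos_half_nonneg[OF t] by simp
  have "(\<integral>\<^sup>+\<omega>. ennreal (exp_neg (ennreal s * I_IC1 p X \<omega>)) \<partial>M) =
      (\<integral>\<^sup>+\<omega>. ennreal (exp_neg (sum_points (\<lambda>i x. ?f (x, sigma_v X i \<omega>)) (Phi_IC1 X \<omega>))) \<partial>M)"
  proof (rule nn_integral_cong_AE)
    show "AE \<omega> in M. ennreal (exp_neg (ennreal s * I_IC1 p X \<omega>)) =
        ennreal (exp_neg (sum_points (\<lambda>i x. ?f (x, sigma_v X i \<omega>)) (Phi_IC1 X \<omega>)))"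
      using AE by eventually_elim (simp add: I_IC1_def sum_points_cmult)
  qed
  also have "\<dots> = ennreal (exp_neg (ennreal (2 * pi * (lam_BS p / real (n_freq p))) *
      (\<integral>\<^sup>+y\<in>{R..}. ennreal (p_LOS p y * (1 - ?\<psi> y) * y) \<partial>lborel)))"
  proof (rule radial_marked_ppp_laplace[OF M P])
    show "0 \<le> ?\<psi> y \<and> ?\<psi> y \<le> 1" for y
    proof -
      have "0 \<le> s * cos (t / 2) * y powr (- eta_L p) * sig_t p"
        by (rule mult_nonneg_nonneg[OF c less_imp_le[OF pos(2)]])
      then show ?thesis by (simp add: divide_le_eq_1)
    qed
    show "(\<integral>\<^sup>+h. ennreal (exp_neg (?f (x, h))) \<partial>exponential_law (sig_t p)) = ennreal (?\<psi> (norm x))" for x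
      using exponential_law_laplace[OF pos(2) c[of "norm x"]] s
      by (simp add: ennreal_mult'[symmetric] mult.assoc)
  qed (use R pos in \<open>auto simp: p_LOS_def\<close>)
  finally show ?thesis by simp
qed

text \<open>Each mark is itself a clutter sum, so its transform enters as the hypothesis
  \<open>lap\<close>, evaluated at the path loss of the point. The mark law D stays abstract because
  in the model it is the law of \<open>S_b\<close> under an outer measure, not under M.\<close>

lemma I_IC2_laplace:
  assumes M: "prob_space M" and p: "valid_radar p"
    and P: "iid_marked_ppp M (exterior_intensity R (\<lambda>r. p_LOS p r * lam_BS p / real (n_freq p)))
      D (Phi_IC2 X) (S_v X)" and D [measurable_cong]: "sets D = sets borel"
    and lap: "\<And>c. 0 \<le> c \<Longrightarrow> (\<integral>\<^sup>+h. ennreal (exp_neg (ennreal c * h)) \<partial>D) =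
      ennreal (exp (- lam_cl p * a * (c * sig_cl p / (1 + c * sig_cl p))))" and a: "0 \<le> a"
    and AE: "AE \<omega> in M. beta_I X \<omega> = t" and R: "0 \<le> R" and t: "0 \<le> t" "t \<le> pi" and s: "0 \<le> s"
  shows "(\<integral>\<^sup>+\<omega>. ennreal (exp_neg (ennreal s * I_IC2 p X \<omega>)) \<partial>M) =
    ennreal (exp_neg (ennreal (lam_BS p / real (n_freq p)) *
      (\<integral>\<^sup>+y\<in>{R..}. ennreal (p_LOS p y *
         (1 - exp (- lam_cl p * a * (s * cos (t / 2) * y powr (- eta_L p) * sig_cl p /
                         (1 + s * cos (t / 2) * y powr (- eta_L p) * sig_cl p)))) * (2 * pi * y)) \<partial>lborel)))"
proof -
  have pos: "0 < lam_BS p" "0 < lam_cl p" "0 < sig_cl p" "0 < n_freq p" using p by (auto simp: valid_radar_def)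
  let ?f = "\<lambda>(x :: real^2, h). ennreal s * (ennreal (cos (t / 2) * norm x powr (- eta_L p)) * h)"
  let ?\<psi> = "\<lambda>y. exp (- lam_cl p * a * (s * cos (t / 2) * y powr (- eta_L p) * sig_cl p /
                         (1 + s * cos (t / 2) * y powr (- eta_L p) * sig_cl p)))"
  have c: "0 \<le> s * cos (t / 2) * y powr (- eta_L p)" for y
    using s cos_half_nonneg[OF t] by simp
  have "(\<integral>\<^sup>+\<omega>. ennreal (exp_neg (ennreal s * I_IC2 p X \<omega>)) \<partial>M) =
      (\<integral>\<^sup>+\<omega>. ennreal (exp_neg (sum_points (\<lambda>i x. ?f (x, S_v X i \<omega>)) (Phi_IC2 X \<omega>))) \<partial>M)"
  proof (rule nn_integral_cong_AE)
    show "AE \<omega> in M. ennreal (exp_neg (ennreal s * I_IC2 p X \<omega>)) =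
        ennreal (exp_neg (sum_points (\<lambda>i x. ?f (x, S_v X i \<omega>)) (Phi_IC2 X \<omega>)))"
      using AE by eventually_elim (simp add: I_IC2_def sum_points_cmult)
  qed
  also have "\<dots> = ennreal (exp_neg (ennreal (2 * pi * (lam_BS p / real (n_freq p))) *
      (\<integral>\<^sup>+y\<in>{R..}. ennreal (p_LOS p y * (1 - ?\<psi> y) * y) \<partial>lborel)))"
  proof (rule radial_marked_ppp_laplace[OF M P])
    show "0 \<le> ?\<psi> y \<and> ?\<psi> y \<le> 1" for y
      using c[of y] pos a by (simp add: mult_nonneg_nonneg)
    show "(\<integral>\<^sup>+h. ennreal (exp_neg (?f (x, h))) \<partial>D) = ennreal (?\<psi> (norm x))" for x
      using lap[OF c[of "norm x"]] s cos_half_nonneg[OF t]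
      by (simp add: ennreal_mult'[symmetric] mult.assoc[symmetric])
  qed (use R pos in \<open>auto simp: p_LOS_def\<close>)
  also have "ennreal (2 * pi * (lam_BS p / real (n_freq p))) *
      (\<integral>\<^sup>+y\<in>{R..}. ennreal (p_LOS p y * (1 - ?\<psi> y) * y) \<partial>lborel) =
    ennreal (lam_BS p / real (n_freq p)) * (ennreal (2 * pi) *
      (\<integral>\<^sup>+y\<in>{R..}. ennreal (p_LOS p y * (1 - ?\<psi> y) * y) \<partial>lborel))"
  proof -
    \<comment> \<open>In the second factor of \<open>L_IC\<close> the constant 2 * pi stands inside
      the integral, in the first one outside.\<close>
    have "2 * pi * (lam_BS p / real (n_freq p)) = lam_BS p / real (n_freq p) * (2 * pi)" by simp
    moreover have "0 \<le> lam_BS p / real (n_freq p)" "0 \<le> 2 * pi" using pos by simp_all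
    then have "ennreal (lam_BS p / real (n_freq p) * (2 * pi)) = ennreal (lam_BS p / real (n_freq p)) * ennreal (2 * pi)"
      by (rule ennreal_mult)
    ultimately show ?thesis by (simp only: mult.assoc)
  qed
  also have "ennreal (2 * pi) * (\<integral>\<^sup>+y\<in>{R..}. ennreal (p_LOS p y * (1 - ?\<psi> y) * y) \<partial>lborel) =
      (\<integral>\<^sup>+y. ennreal (2 * pi) * (ennreal (p_LOS p y * (1 - ?\<psi> y) * y) * indicator {R..} y) \<partial>lborel)"
    by (rule nn_integral_cmult[symmetric]) simp
  also have "\<dots> = (\<integral>\<^sup>+y\<in>{R..}. ennreal (p_LOS p y * (1 - ?\<psi> y) * (2 * pi * y)) \<partial>lborel)"
    by (intro nn_integral_cong) (auto split: split_indicator simp: ennreal_mult'[symmetric] mult_ac)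
  finally show ?thesis .
qed

text \<open>Integrates out \<open>(R_n, beta)\<close> and \<open>(R_IC, beta_I)\<close>. Here w is
  an integral against the kernel, whose measurability is known, and w' is an explicit expression
  that agrees with it only almost everywhere on the support of the densities. The exchange is made
  one section at a time, so joint measurability of w' never has to be shown.\<close>

lemma nn_integral_distr_indep_densities:
  fixes U V :: "'w \<Rightarrow> real"
  assumes M: "prob_space M" and U: "distributed M lborel U f" and V: "distributed M lborel V g"
    and ind: "prob_space.indep_var M borel U borel V"
    and w [measurable]: "w \<in> borel_measurable borel"
    and AE: "AE z in distr M borel (\<lambda>\<omega>. (U \<omega>, V \<omega>)). f (fst z) \<noteq> 0 \<longrightarrow> g (snd z) \<noteq> 0 \<longrightarrow> w z = w' z"
  shows "(\<integral>\<^sup>+z. w z \<partial>distr M borel (\<lambda>\<omega>. (U \<omega>, V \<omega>))) = (\<integral>\<^sup>+x. \<integral>\<^sup>+y. f x * (g y * w' (x, y)) \<partial>lborel \<partial>lborel)"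
proof -
  interpret prob_space M by fact
  have f [measurable]: "f \<in> borel_measurable lborel" and g [measurable]: "g \<in> borel_measurable lborel"
    using U V by (auto simp: distributed_def)
  have [measurable]: "U \<in> borel_measurable M" "V \<in> borel_measurable M"
    using U V by (auto simp: distributed_def)
  have dU: "distr M borel U = density lborel f" and dV: "distr M borel V = density lborel g"
    using U V by (auto simp: distributed_def cong: distr_cong)
  interpret U: prob_space "density lborel f" unfolding dU[symmetric] by (rule prob_space_distr) simp
  interpret V: prob_space "density lborel g" unfolding dV[symmetric] by (rule prob_space_distr) simp
  have eq: "distr M borel (\<lambda>\<omega>. (U \<omega>, V \<omega>)) = density lborel f \<Otimes>\<^sub>M density lborel g"
    using ind by (simp add: indep_var_distribution_eq borel_prod dU dV)
  have w': "w \<in> borel_measurable (density lborel f \<Otimes>\<^sub>M density lborel g)"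
    using w by (simp add: borel_prod[symmetric] cong: measurable_cong_sets)
  have [measurable]: "(\<lambda>x. \<integral>\<^sup>+y. w (x, y) \<partial>density lborel g) \<in> borel_measurable borel"
    using V.borel_measurable_nn_integral_fst[OF w'] by simp
  have "(\<integral>\<^sup>+z. w z \<partial>distr M borel (\<lambda>\<omega>. (U \<omega>, V \<omega>))) = (\<integral>\<^sup>+x. \<integral>\<^sup>+y. w (x, y) \<partial>density lborel g \<partial>density lborel f)"
    unfolding eq by (rule V.nn_integral_fst[OF w', symmetric])
  also have "\<dots> = (\<integral>\<^sup>+x. f x * (\<integral>\<^sup>+y. w (x, y) \<partial>density lborel g) \<partial>lborel)"
    by (rule nn_integral_density) auto
  also have "\<dots> = (\<integral>\<^sup>+x. \<integral>\<^sup>+y. f x * (g y * w (x, y)) \<partial>lborel \<partial>lborel)"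
    by (intro nn_integral_cong) (simp add: nn_integral_density nn_integral_cmult)
  also have "\<dots> = (\<integral>\<^sup>+x. \<integral>\<^sup>+y. f x * (g y * w' (x, y)) \<partial>lborel \<partial>lborel)"
  proof (rule nn_integral_cong_AE)
    have "AE x in density lborel f. AE y in density lborel g. f x \<noteq> 0 \<longrightarrow> g y \<noteq> 0 \<longrightarrow> w (x, y) = w' (x, y)"
      using pair_sigma_finite.AE_pair[OF pair_sigma_finite.intro[OF U.sigma_finite_measure_axioms V.sigma_finite_measure_axioms] AE[unfolded eq]] by simp
    then show "AE x in lborel. (\<integral>\<^sup>+y. f x * (g y * w (x, y)) \<partial>lborel) = (\<integral>\<^sup>+y. f x * (g y * w' (x, y)) \<partial>lborel)"
      unfolding AE_density[OF f]
    proof eventually_elim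
      case (elim x)
      show ?case
      proof (cases "f x = 0")
        case False
        then have "AE y in density lborel g. g y \<noteq> 0 \<longrightarrow> w (x, y) = w' (x, y)"
          using elim by (simp add: zero_less_iff_neq_zero)
        then show ?thesis
          unfolding AE_density[OF g]
          by (intro nn_integral_cong_AE, eventually_elim) (auto simp: zero_less_iff_neq_zero)
      qed simp
    qed
  qed
  finally show ?thesis .
qed

lemma L_IC_laplace:
  assumes Q: "prob_space Q" and p: "valid_radar p" and R1: "0 < R1"
    and C: "inter_clutter_model p R1 A_rb X Q"
    and S [measurable]: "S_b A_rb X \<in> borel_measurable Q"
    and lap: "\<And>c. 0 \<le> c \<Longrightarrow> (\<integral>\<^sup>+\<omega>. ennreal (exp_neg (ennreal c * S_b A_rb X \<omega>)) \<partial>Q) =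
      ennreal (exp (- lam_cl p * cell_area p r b * (c * sig_cl p / (1 + c * sig_cl p))))"
    and a: "0 \<le> cell_area p r b"
    and I [measurable]: "I_IC1 p X \<in> borel_measurable Q" "I_IC2 p X \<in> borel_measurable Q"
    and s: "0 \<le> s"
  shows "(\<integral>\<^sup>+\<omega>. ennreal (exp_neg (ennreal s * (I_IC1 p X \<omega> + I_IC2 p X \<omega>))) \<partial>Q) = L_IC p R1 s r b"
proof -
  have pos: "0 < lam_BS p" using p by (auto simp: valid_radar_def)
  define A where "A ric t = exp_neg (ennreal (2 * pi * lam_BS p / real (n_freq p)) *
          (\<integral>\<^sup>+y\<in>{ric..}. ennreal (p_LOS p y *
             (1 - 1 / (1 + s * cos (t / 2) * y powr (- eta_L p) * sig_t p)) * y) \<partial>lborel))" for ric t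
  define B where "B ric t = exp_neg (ennreal (lam_BS p / real (n_freq p)) *
          (\<integral>\<^sup>+y\<in>{ric..}. ennreal (p_LOS p y *
             (1 - exp (- lam_cl p * cell_area p r b *
                        (s * cos (t / 2) * y powr (- eta_L p) * sig_cl p /
                         (1 + s * cos (t / 2) * y powr (- eta_L p) * sig_cl p)))) *
             (2 * pi * y)) \<partial>lborel))" for ric t
  let ?f = "\<lambda>x. ennreal (2 * pi * lam_BS p * x * exp (- lam_BS p * pi * (x\<^sup>2 - R1\<^sup>2))) * indicator {R1..} x"
  let ?g = "\<lambda>b. ennreal (indicator {0..pi} b / pi)"
  let ?h = "\<lambda>\<omega>. ennreal (exp_neg (ennreal s * (I_IC1 p X \<omega> + I_IC2 p X \<omega>)))"
  let ?Z = "\<lambda>\<omega>. (R_IC X \<omega>, beta_I X \<omega>)"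
  have dR: "distributed Q lborel (R_IC X) ?f" and d\<beta>: "distributed Q lborel (beta_I X) ?g"
    and ind: "prob_space.indep_var Q borel (R_IC X) borel (beta_I X)"
    using C by (auto simp: inter_clutter_model_def uniform_angle_def)
  let ?Q = "\<lambda>ric Q'. let \<Lambda> = exterior_intensity ric (\<lambda>r. p_LOS p r * lam_BS p / real (n_freq p)) in
        iid_marked_ppp Q' \<Lambda> (exponential_law (sig_t p)) (Phi_IC1 X) (sigma_v X) \<and>
        iid_marked_ppp Q' \<Lambda> (distr Q borel (S_b A_rb X)) (Phi_IC2 X) (S_v X) \<and>
        prob_space.indep_var Q' borel (I_IC1 p X) borel (I_IC2 p X)"
  obtain K where K: "regular_conditional_probability Q borel ?Z K"
    and AEK: "AE z in distr Q borel ?Z. ?Q (fst z) (K z)"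
    using C unfolding inter_clutter_model_def conditionally_on_def split_beta' by blast
  have "AE z in distr Q borel ?Z. ?f (fst z) \<noteq> 0 \<longrightarrow> ?g (snd z) \<noteq> 0 \<longrightarrow>
      (\<integral>\<^sup>+\<omega>. ?h \<omega> \<partial>K z) = ennreal (A (fst z) (snd z)) * ennreal (B (fst z) (snd z))"
    using AEK regular_conditional_probability_AE_eq[OF Q K]
  proof eventually_elim
    case (elim z)
    show ?case
    proof (intro impI)
      \<comment> \<open>Nonzero densities confine z to radii at least \<open>R1\<close> and to
        angles in [0, pi], where the cosine of half the angle is nonnegative.\<close>
      assume "?f (fst z) \<noteq> 0" "?g (snd z) \<noteq> 0"
      then have z: "R1 \<le> fst z" "0 \<le> snd z" "snd z \<le> pi"
        by (auto simp: indicator_def split: if_splits)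
      interpret Kz: prob_space "K z"
        by (rule regular_conditional_probability_kernel[OF K]) simp
      note [measurable_cong] = regular_conditional_probability_kernel(2)[OF K, of z, simplified]
      have P1: "iid_marked_ppp (K z) (exterior_intensity (fst z) (\<lambda>r. p_LOS p r * lam_BS p / real (n_freq p)))
          (exponential_law (sig_t p)) (Phi_IC1 X) (sigma_v X)"
        and P2: "iid_marked_ppp (K z) (exterior_intensity (fst z) (\<lambda>r. p_LOS p r * lam_BS p / real (n_freq p)))
          (distr Q borel (S_b A_rb X)) (Phi_IC2 X) (S_v X)"
        and I12: "Kz.indep_var borel (I_IC1 p X) borel (I_IC2 p X)"
        using elim(1) by (simp_all add: Let_def)
      have AE\<beta>: "AE \<omega> in K z. beta_I X \<omega> = snd z"
        using elim(2) by eventually_elim auto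
      have ind: "Kz.indep_var borel (\<lambda>\<omega>. ennreal (exp_neg (ennreal s * I_IC1 p X \<omega>)))
          borel (\<lambda>\<omega>. ennreal (exp_neg (ennreal s * I_IC2 p X \<omega>)))"
        by (rule Kz.indep_var_compose[OF I12, unfolded comp_def]) measurable
      have "(\<integral>\<^sup>+\<omega>. ?h \<omega> \<partial>K z) =
          (\<integral>\<^sup>+\<omega>. ennreal (exp_neg (ennreal s * I_IC1 p X \<omega>)) * ennreal (exp_neg (ennreal s * I_IC2 p X \<omega>)) \<partial>K z)"
        by (simp add: distrib_left exp_neg_add ennreal_mult)
      also have "\<dots> = (\<integral>\<^sup>+\<omega>. ennreal (exp_neg (ennreal s * I_IC1 p X \<omega>)) \<partial>K z) *
          (\<integral>\<^sup>+\<omega>. ennreal (exp_neg (ennreal s * I_IC2 p X \<omega>)) \<partial>K z)"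
        by (rule Kz.indep_var_nn_integral_mult[OF ind])
      also have "(\<integral>\<^sup>+\<omega>. ennreal (exp_neg (ennreal s * I_IC1 p X \<omega>)) \<partial>K z) = ennreal (A (fst z) (snd z))"
        unfolding A_def using z R1 s by (intro I_IC1_laplace[OF Kz.prob_space_axioms p P1 AE\<beta>]) auto
      \<comment> \<open>The marks have the law of \<open>S_b\<close> under Q, so the transform
        \<open>lap\<close> taken under Q is the right one although the process is considered under
        the kernel.\<close>
      also have "(\<integral>\<^sup>+\<omega>. ennreal (exp_neg (ennreal s * I_IC2 p X \<omega>)) \<partial>K z) = ennreal (B (fst z) (snd z))"
        unfolding B_def using z R1 s a
        by (intro I_IC2_laplace[OF Kz.prob_space_axioms p P2 _ _ _ AE\<beta>]) (auto simp: nn_integral_distr lap)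
      finally show "(\<integral>\<^sup>+\<omega>. ?h \<omega> \<partial>K z) = ennreal (A (fst z) (snd z)) * ennreal (B (fst z) (snd z))" .
    qed
  qed
  note AE = this
  have h: "?h \<in> borel_measurable Q" by measurable
  have "(\<integral>\<^sup>+\<omega>. ?h \<omega> \<partial>Q) = (\<integral>\<^sup>+z. (\<integral>\<^sup>+\<omega>. ?h \<omega> \<partial>K z) \<partial>distr Q borel ?Z)"
    by (rule nn_integral_regular_conditional_probability[OF Q K h])
  also have "\<dots> = (\<integral>\<^sup>+x. \<integral>\<^sup>+y. ?f x * (?g y * (\<lambda>z. ennreal (A (fst z) (snd z)) * ennreal (B (fst z) (snd z))) (x, y)) \<partial>lborel \<partial>lborel)"
    by (rule nn_integral_distr_indep_densities[OF Q dR d\<beta> ind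
        nn_integral_regular_conditional_probability(2)[OF Q K h] AE])
  also have "\<dots> = L_IC p R1 s r b"
    unfolding L_IC_def A_def[symmetric] B_def[symmetric]
  proof (intro nn_integral_cong)
    fix x
    show "(\<integral>\<^sup>+y. ?f x * (?g y * (\<lambda>z. ennreal (A (fst z) (snd z)) * ennreal (B (fst z) (snd z))) (x, y)) \<partial>lborel) =
      (\<integral>\<^sup>+t\<in>{0..pi}. ennreal (A x t * B x t * (2 * lam_BS p * x * exp (- lam_BS p * pi * (x\<^sup>2 - R1\<^sup>2)))) \<partial>lborel) * indicator {R1..} x"
    proof (cases "R1 \<le> x")
      case True
      have AB: "0 \<le> A x t" "0 \<le> B x t" for t by (simp_all add: A_def B_def)
      define e where "e = exp (- lam_BS p * pi * (x\<^sup>2 - R1\<^sup>2))"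
      have e: "0 \<le> e" by (simp add: e_def)
      \<comment> \<open>The factor 1 / pi of the uniform angle cancels the pi of the radial density,
        which leaves the constant 2 in \<open>L_IC\<close>.\<close>
      have "ennreal (2 * pi * lam_BS p * x * e) * (ennreal (1 / pi) * (ennreal (A x t) * ennreal (B x t))) =
          ennreal (A x t * B x t * (2 * lam_BS p * x * e))" for t
      proof -
        have "2 * pi * lam_BS p * x * e * (1 / pi * (A x t * B x t)) = A x t * B x t * (2 * lam_BS p * x * e)"
          by simp
        moreover have "0 \<le> 2 * pi * lam_BS p * x * e" "0 \<le> A x t * B x t" "0 \<le> 1 / pi * (A x t * B x t)"
          using True pos R1 AB e by simp_all
        ultimately show ?thesis
          using AB by (metis ennreal_mult pi_ge_zero divide_nonneg_nonneg zero_le_one)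
      qed
      then show ?thesis
        using True unfolding e_def[symmetric]
        by (auto intro!: nn_integral_cong simp: indicator_def)
    qed simp
  qed
  finally show ?thesis .
qed

text \<open>The left summand of the index type holds one process with its marks, the right summand
  the other. Reindexing gives the two marked processes separately; splitting the indices into the
  two halves decouples the two sums.\<close>

lemma marked_ppp_pair_laplace:
  fixes M :: "'w measure" and D1 :: "'a measure" and D2 :: "'b measure"
    and f1 :: "(real^2) \<times> 'a \<Rightarrow> ennreal" and f2 :: "(real^2) \<times> 'b \<Rightarrow> ennreal"
  assumes M: "prob_space M"
    and P1: "poisson_point_process M \<Lambda>1 \<Phi>1" and P2: "poisson_point_process M \<Lambda>2 \<Phi>2"
    and H1: "iid_with_law M D1 H1" and H2: "iid_with_law M D2 H2"
    and ind: "prob_space.indep_sets M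
      (case_sum
        (case_option (generated_events M configurations \<Phi>1) (\<lambda>i. generated_events M D1 (H1 i)))
        (case_option (generated_events M configurations \<Phi>2) (\<lambda>i. generated_events M D2 (H2 i)))) UNIV"
    and f1 [measurable]: "f1 \<in> borel_measurable (borel \<Otimes>\<^sub>M D1)"
    and f2 [measurable]: "f2 \<in> borel_measurable (borel \<Otimes>\<^sub>M D2)"
  shows "iid_marked_ppp M \<Lambda>1 D1 \<Phi>1 H1" and "iid_marked_ppp M \<Lambda>2 D2 \<Phi>2 H2"
    and "(\<integral>\<^sup>+\<omega>. ennreal (exp_neg (sum_points (\<lambda>i x. f1 (x, H1 i \<omega>)) (\<Phi>1 \<omega>) + sum_points (\<lambda>i x. f2 (x, H2 i \<omega>)) (\<Phi>2 \<omega>))) \<partial>M) =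
      (\<integral>\<^sup>+\<omega>. ennreal (exp_neg (sum_points (\<lambda>i x. f1 (x, H1 i \<omega>)) (\<Phi>1 \<omega>))) \<partial>M) *
      (\<integral>\<^sup>+\<omega>. ennreal (exp_neg (sum_points (\<lambda>i x. f2 (x, H2 i \<omega>)) (\<Phi>2 \<omega>))) \<partial>M)"
proof -
  interpret prob_space M by fact
  let ?F1 = "case_option (generated_events M configurations \<Phi>1) (\<lambda>i. generated_events M D1 (H1 i))"
  let ?F2 = "case_option (generated_events M configurations \<Phi>2) (\<lambda>i. generated_events M D2 (H2 i))"
  have "indep_sets (\<lambda>i. case_sum ?F1 ?F2 (Inl i)) UNIV"
    by (rule indep_sets_reindex[OF indep_sets_mono_index[OF subset_UNIV ind] inj_Inl])
  moreover have "indep_sets (\<lambda>i. case_sum ?F1 ?F2 (Inr i)) UNIV"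
    by (rule indep_sets_reindex[OF indep_sets_mono_index[OF subset_UNIV ind] inj_Inr])
  ultimately show "iid_marked_ppp M \<Lambda>1 D1 \<Phi>1 H1" "iid_marked_ppp M \<Lambda>2 D2 \<Phi>2 H2"
    using P1 P2 H1 H2 by (simp_all add: iid_marked_ppp_def)
  have \<Phi> [measurable]: "\<Phi>1 \<in> measurable M configurations" "\<Phi>2 \<in> measurable M configurations"
    using P1 P2 by (auto simp: poisson_point_process_def)
  have H [measurable]: "H1 i \<in> measurable M D1" "H2 i \<in> measurable M D2" for i
    using H1 H2 by (auto simp: iid_with_law_def indep_vars_def)
  define S where "S i = sigma (space M) (case_sum ?F1 ?F2 i)" for i
  have S: "indep_vars S (\<lambda>_ \<omega>. \<omega>) UNIV"
    unfolding S_def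
    by (rule indep_sets_imp_indep_vars_identity[OF ind])
      (auto split: option.split sum.split simp: generated_events_Int_stable)
  have [measurable]: "\<Phi>1 \<in> measurable (S (Inl None)) configurations" "\<Phi>2 \<in> measurable (S (Inr None)) configurations"
    unfolding S_def using measurable_space[OF \<Phi>(1)] measurable_space[OF \<Phi>(2)]
    by (auto intro!: measurable_generated_events)
  have [measurable]: "H1 i \<in> measurable (S (Inl (Some i))) D1" "H2 i \<in> measurable (S (Inr (Some i))) D2" for i
    unfolding S_def using measurable_space[OF H(1)] measurable_space[OF H(2)]
    by (auto intro!: measurable_generated_events)
  let ?a = "\<lambda>u :: nat option + nat option \<Rightarrow> 'w. ennreal (exp_neg (sum_points (\<lambda>i x. f1 (x, H1 i (u (Inl (Some i))))) (\<Phi>1 (u (Inl None)))))"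
  let ?b = "\<lambda>v :: nat option + nat option \<Rightarrow> 'w. ennreal (exp_neg (sum_points (\<lambda>i x. f2 (x, H2 i (v (Inr (Some i))))) (\<Phi>2 (v (Inr None)))))"
  let ?G = "\<lambda>(u, v). ?a u * ?b v"
  have [measurable]: "(\<lambda>u. sum_points (\<lambda>i x. f1 (x, H1 i (u (Inl (Some i))))) (\<Phi>1 (u (Inl None)))) \<in> borel_measurable (PiM (range Inl) S)"
    by (rule measurable_sum_points_marked[where D=D1]) measurable
  have [measurable]: "(\<lambda>v. sum_points (\<lambda>i x. f2 (x, H2 i (v (Inr (Some i))))) (\<Phi>2 (v (Inr None)))) \<in> borel_measurable (PiM (range Inr) S)"
    by (rule measurable_sum_points_marked[where D=D2]) measurable
  have "(\<integral>\<^sup>+\<omega>. ?G (restrict (\<lambda>_. \<omega>) (range Inl), restrict (\<lambda>_. \<omega>) (range Inr)) \<partial>M) =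
    (\<integral>\<^sup>+\<omega>. \<integral>\<^sup>+\<omega>'. ?G (restrict (\<lambda>_. \<omega>) (range Inl), restrict (\<lambda>_. \<omega>') (range Inr)) \<partial>M \<partial>M)"
    by (rule indep_vars_nn_integral_split[OF S, where J="range Inl" and K="range Inr" and G="?G"]) auto
  moreover have [measurable]: "(\<lambda>\<omega>. sum_points (\<lambda>i x. f1 (x, H1 i \<omega>)) (\<Phi>1 \<omega>)) \<in> borel_measurable M"
    by (rule measurable_sum_points_marked[where D=D1]) measurable
  moreover have [measurable]: "(\<lambda>\<omega>. sum_points (\<lambda>i x. f2 (x, H2 i \<omega>)) (\<Phi>2 \<omega>)) \<in> borel_measurable M"
    by (rule measurable_sum_points_marked[where D=D2]) measurable
  ultimately show "(\<integral>\<^sup>+\<omega>. ennreal (exp_neg (sum_points (\<lambda>i x. f1 (x, H1 i \<omega>)) (\<Phi>1 \<omega>) + sum_points (\<lambda>i x. f2 (x, H2 i \<omega>)) (\<Phi>2 \<omega>))) \<partial>M) =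
      (\<integral>\<^sup>+\<omega>. ennreal (exp_neg (sum_points (\<lambda>i x. f1 (x, H1 i \<omega>)) (\<Phi>1 \<omega>))) \<partial>M) *
      (\<integral>\<^sup>+\<omega>. ennreal (exp_neg (sum_points (\<lambda>i x. f2 (x, H2 i \<omega>)) (\<Phi>2 \<omega>))) \<partial>M)"
    by (simp add: exp_neg_add ennreal_mult nn_integral_cmult nn_integral_multc)
qed

lemma gamma_marked_ppp_laplace:
  assumes M: "prob_space M"
    and P: "iid_marked_ppp M (exterior_intensity R g) (unit_mean_gamma_law m) \<Phi> H"
    and m: "0 < m" and c: "0 \<le> c"
    and g [measurable]: "g \<in> borel_measurable borel" and R: "0 \<le> R"
    and gq: "\<And>y. R \<le> y \<Longrightarrow> g y = k * q y" "0 \<le> k" "\<And>y. R \<le> y \<Longrightarrow> 0 \<le> q y"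
    and q [measurable]: "q \<in> borel_measurable borel"
  shows "(\<integral>\<^sup>+\<omega>. ennreal (exp_neg (sum_points (\<lambda>i x. ennreal (c * norm x powr (- \<eta>) * H i \<omega>)) (\<Phi> \<omega>))) \<partial>M) =
    ennreal (exp_neg (ennreal (2 * pi * k) *
      (\<integral>\<^sup>+y\<in>{R..}. ennreal (q y * (1 - (1 + c * y powr (- \<eta>) / m) powr (- m)) * y) \<partial>lborel)))"
proof -
  let ?f = "\<lambda>(x :: real^2, h). ennreal (c * norm x powr (- \<eta>) * h)"
  let ?\<psi> = "\<lambda>y. (1 + c * y powr (- \<eta>) / m) powr (- m)"
  have "(\<integral>\<^sup>+\<omega>. ennreal (exp_neg (sum_points (\<lambda>i x. ?f (x, H i \<omega>)) (\<Phi> \<omega>))) \<partial>M) =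
    ennreal (exp_neg (ennreal (2 * pi * k) * (\<integral>\<^sup>+y\<in>{R..}. ennreal (q y * (1 - ?\<psi> y) * y) \<partial>lborel)))"
  proof (rule radial_marked_ppp_laplace[OF M P _ g R gq q])
    show "0 \<le> ?\<psi> y \<and> ?\<psi> y \<le> 1" for y
    proof -
      have "1 \<le> 1 + c * y powr (- \<eta>) / m" using m c by simp
      then have "1 \<le> (1 + c * y powr (- \<eta>) / m) powr m" using m by (intro ge_one_powr_ge_zero) auto
      then show ?thesis by (simp add: powr_minus inverse_le_1_iff)
    qed
    show "(\<integral>\<^sup>+h. ennreal (exp_neg (?f (x, h))) \<partial>unit_mean_gamma_law m) = ennreal (?\<psi> (norm x))" for x
      using unit_mean_gamma_law_laplace[OF m, of "c * norm x powr (- \<eta>)"] c by simp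
  qed simp_all
  then show ?thesis by simp
qed

text \<open>Line-of-sight and other interferers are independent only once \<open>R_d\<close> is
  fixed, since both processes avoid the same disc; hence the factorisation takes place under the
  kernel.\<close>

lemma L_D_laplace:
  assumes Q: "prob_space Q" and p: "valid_radar p" and C: "direct_interference_model p X Q"
    and I [measurable]: "I_L p X \<in> borel_measurable Q" "I_N p X \<in> borel_measurable Q"
    and s: "0 \<le> s"
  shows "(\<integral>\<^sup>+\<omega>. ennreal (exp_neg (ennreal s * (I_L p X \<omega> + I_N p X \<omega>))) \<partial>Q) = L_D p s"
proof -
  have pos: "0 < lam_BS p" "0 < n_freq p" "0 < m_L p" "0 < m_N p" "0 < P_c p" "0 < C_L p" "0 < C_N p" "0 < blockage p"
    using p by (auto simp: valid_radar_def)
  define A where "A rd = exp_neg (ennreal (2 * pi * lam_BS p / (real (n_freq p))\<^sup>2) *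
          (\<integral>\<^sup>+y\<in>{rd..}. ennreal (p_LOS p y *
             (1 - (1 + s * P_c p * (G_m p)\<^sup>2 * C_L p * y powr (- eta_L p) / m_L p)
                    powr (- m_L p)) * y) \<partial>lborel))" for rd
  define B where "B rd = exp_neg (ennreal (2 * pi * lam_BS p / (real (n_freq p))\<^sup>2) *
          (\<integral>\<^sup>+y\<in>{rd..}. ennreal ((1 - p_LOS p y) *
             (1 - (1 + s * P_c p * (G_m p)\<^sup>2 * C_N p * y powr (- eta_N p) / m_N p)
                    powr (- m_N p)) * y) \<partial>lborel))" for rd
  let ?f = "\<lambda>x. ennreal (2 * pi * lam_BS p * x * exp (- pi * lam_BS p * x\<^sup>2)) * indicator {0..} x"
  let ?h = "\<lambda>\<omega>. ennreal (exp_neg (ennreal s * (I_L p X \<omega> + I_N p X \<omega>)))"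
  let ?gL = "\<lambda>r. p_LOS p r * lam_BS p / (real (n_freq p))\<^sup>2"
  let ?gN = "\<lambda>r. (1 - p_LOS p r) * lam_BS p / (real (n_freq p))\<^sup>2"
  have dR: "distributed Q lborel (R_d X) ?f"
    using C by (simp add: direct_interference_model_def)
  have fm [measurable]: "?f \<in> borel_measurable lborel" by measurable
  have dQ: "distr Q borel (R_d X) = density lborel ?f"
    using dR by (auto simp: distributed_def cong: distr_cong)
  let ?Q = "\<lambda>rd Q'. poisson_point_process Q' (exterior_intensity rd ?gL) (Phi_L X) \<and>
       poisson_point_process Q' (exterior_intensity rd ?gN) (Phi_N X) \<and>
       iid_with_law Q' (unit_mean_gamma_law (m_L p)) (h_L X) \<and>
       iid_with_law Q' (unit_mean_gamma_law (m_N p)) (h_N X) \<and>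
       prob_space.indep_sets Q'
         (case_sum
           (case_option (generated_events Q' configurations (Phi_L X))
                        (\<lambda>i. generated_events Q' borel (h_L X i)))
           (case_option (generated_events Q' configurations (Phi_N X))
                        (\<lambda>i. generated_events Q' borel (h_N X i)))) UNIV"
  obtain K where K: "regular_conditional_probability Q borel (R_d X) K"
    and AEK: "AE z in distr Q borel (R_d X). ?Q z (K z)"
    using C unfolding direct_interference_model_def conditionally_on_def by blast
  have "AE z in distr Q borel (R_d X). 0 \<le> z \<longrightarrow> (\<integral>\<^sup>+\<omega>. ?h \<omega> \<partial>K z) = ennreal (A z) * ennreal (B z)"
    using AEK
  proof eventually_elim
    case (elim z)
    show ?case
    proof
      assume z: "0 \<le> z"
      have Kz: "prob_space (K z)"
        by (rule regular_conditional_probability_kernel[OF K]) simp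
      let ?c = "\<lambda>C. s * P_c p * (G_m p)\<^sup>2 * C"
      let ?fL = "\<lambda>(x :: real^2, h). ennreal (?c (C_L p) * norm x powr (- eta_L p) * h)"
      let ?fN = "\<lambda>(x :: real^2, h). ennreal (?c (C_N p) * norm x powr (- eta_N p) * h)"
      \<comment> \<open>The model generates events from Borel sets, the lemma on pairs from the sets
        of the mark law; these \<sigma>-algebras coincide.\<close>
      have ge: "generated_events (K z) borel Y = generated_events (K z) (unit_mean_gamma_law m) Y" for Y m
        by (simp add: generated_events_def sets_unit_mean_gamma_law)
      have pair: "iid_marked_ppp (K z) (exterior_intensity z ?gL) (unit_mean_gamma_law (m_L p)) (Phi_L X) (h_L X)"
        "iid_marked_ppp (K z) (exterior_intensity z ?gN) (unit_mean_gamma_law (m_N p)) (Phi_N X) (h_N X)"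
        "(\<integral>\<^sup>+\<omega>. ennreal (exp_neg (sum_points (\<lambda>i x. ?fL (x, h_L X i \<omega>)) (Phi_L X \<omega>) +
            sum_points (\<lambda>i x. ?fN (x, h_N X i \<omega>)) (Phi_N X \<omega>))) \<partial>K z) =
          (\<integral>\<^sup>+\<omega>. ennreal (exp_neg (sum_points (\<lambda>i x. ?fL (x, h_L X i \<omega>)) (Phi_L X \<omega>))) \<partial>K z) *
          (\<integral>\<^sup>+\<omega>. ennreal (exp_neg (sum_points (\<lambda>i x. ?fN (x, h_N X i \<omega>)) (Phi_N X \<omega>))) \<partial>K z)"
      proof -
        have 1: "poisson_point_process (K z) (exterior_intensity z ?gL) (Phi_L X)"
          and 2: "poisson_point_process (K z) (exterior_intensity z ?gN) (Phi_N X)"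
          and 3: "iid_with_law (K z) (unit_mean_gamma_law (m_L p)) (h_L X)"
          and 4: "iid_with_law (K z) (unit_mean_gamma_law (m_N p)) (h_N X)"
          and 5: "prob_space.indep_sets (K z)
            (case_sum
              (case_option (generated_events (K z) configurations (Phi_L X))
                 (\<lambda>i. generated_events (K z) (unit_mean_gamma_law (m_L p)) (h_L X i)))
              (case_option (generated_events (K z) configurations (Phi_N X))
                 (\<lambda>i. generated_events (K z) (unit_mean_gamma_law (m_N p)) (h_N X i)))) UNIV"
          using elim unfolding ge[of _ "m_L p", symmetric] ge[of _ "m_N p", symmetric] by blast+
        note lap = marked_ppp_pair_laplace[OF Kz 1 2 3 4 5, of ?fL ?fN]
        show "iid_marked_ppp (K z) (exterior_intensity z ?gL) (unit_mean_gamma_law (m_L p)) (Phi_L X) (h_L X)"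
          by (rule lap(1)) measurable
        show "iid_marked_ppp (K z) (exterior_intensity z ?gN) (unit_mean_gamma_law (m_N p)) (Phi_N X) (h_N X)"
          by (rule lap(2)) measurable
        show "(\<integral>\<^sup>+\<omega>. ennreal (exp_neg (sum_points (\<lambda>i x. ?fL (x, h_L X i \<omega>)) (Phi_L X \<omega>) +
            sum_points (\<lambda>i x. ?fN (x, h_N X i \<omega>)) (Phi_N X \<omega>))) \<partial>K z) =
          (\<integral>\<^sup>+\<omega>. ennreal (exp_neg (sum_points (\<lambda>i x. ?fL (x, h_L X i \<omega>)) (Phi_L X \<omega>))) \<partial>K z) *
          (\<integral>\<^sup>+\<omega>. ennreal (exp_neg (sum_points (\<lambda>i x. ?fN (x, h_N X i \<omega>)) (Phi_N X \<omega>))) \<partial>K z)"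
          by (rule lap(3)) measurable
      qed
      have IL: "ennreal s * I_L p X \<omega> = sum_points (\<lambda>i x. ?fL (x, h_L X i \<omega>)) (Phi_L X \<omega>)" for \<omega>
        unfolding I_L_def sum_points_cmult[symmetric] using s
        by (simp add: ennreal_mult'[symmetric] mult_ac)
      have IN: "ennreal s * I_N p X \<omega> = sum_points (\<lambda>i x. ?fN (x, h_N X i \<omega>)) (Phi_N X \<omega>)" for \<omega>
        unfolding I_N_def sum_points_cmult[symmetric] using s
        by (simp add: ennreal_mult'[symmetric] mult_ac)
      have "(\<integral>\<^sup>+\<omega>. ?h \<omega> \<partial>K z) =
          (\<integral>\<^sup>+\<omega>. ennreal (exp_neg (sum_points (\<lambda>i x. ?fL (x, h_L X i \<omega>)) (Phi_L X \<omega>))) \<partial>K z) *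
          (\<integral>\<^sup>+\<omega>. ennreal (exp_neg (sum_points (\<lambda>i x. ?fN (x, h_N X i \<omega>)) (Phi_N X \<omega>))) \<partial>K z)"
        unfolding distrib_left IL IN by (rule pair(3))
      also have "(\<integral>\<^sup>+\<omega>. ennreal (exp_neg (sum_points (\<lambda>i x. ?fL (x, h_L X i \<omega>)) (Phi_L X \<omega>))) \<partial>K z) = ennreal (A z)"
        using gamma_marked_ppp_laplace[OF Kz pair(1), of "?c (C_L p)" "lam_BS p / (real (n_freq p))\<^sup>2" "p_LOS p" "eta_L p"]
          pos s z unfolding A_def by (simp add: p_LOS_def)
      also have "(\<integral>\<^sup>+\<omega>. ennreal (exp_neg (sum_points (\<lambda>i x. ?fN (x, h_N X i \<omega>)) (Phi_N X \<omega>))) \<partial>K z) = ennreal (B z)"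
        using gamma_marked_ppp_laplace[OF Kz pair(2), of "?c (C_N p)" "lam_BS p / (real (n_freq p))\<^sup>2" "\<lambda>y. 1 - p_LOS p y" "eta_N p"]
          pos s z unfolding B_def by (simp add: p_LOS_def)
      finally show "(\<integral>\<^sup>+\<omega>. ?h \<omega> \<partial>K z) = ennreal (A z) * ennreal (B z)" .
    qed
  qed
  note AE = this[unfolded dQ, unfolded AE_density[OF fm]]
  have h: "?h \<in> borel_measurable Q" by measurable
  note [measurable] = nn_integral_regular_conditional_probability(2)[OF Q K h]
  have "(\<integral>\<^sup>+\<omega>. ?h \<omega> \<partial>Q) = (\<integral>\<^sup>+z. (\<integral>\<^sup>+\<omega>. ?h \<omega> \<partial>K z) \<partial>distr Q borel (R_d X))"
    by (rule nn_integral_regular_conditional_probability[OF Q K h])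
  also have "\<dots> = (\<integral>\<^sup>+z. ?f z * (\<integral>\<^sup>+\<omega>. ?h \<omega> \<partial>K z) \<partial>lborel)"
    unfolding dQ by (rule nn_integral_density) auto
  also have "\<dots> = L_D p s"
    unfolding L_D_def A_def[symmetric] B_def[symmetric]
  proof (rule nn_integral_cong_AE)
    show "AE z in lborel. ?f z * (\<integral>\<^sup>+\<omega>. ?h \<omega> \<partial>K z) =
        ennreal (A z * B z * (2 * pi * lam_BS p * z * exp (- pi * lam_BS p * z\<^sup>2))) * indicator {0..} z"
      using AE
    proof eventually_elim
      case (elim z)
      have AB: "0 \<le> A z" "0 \<le> B z" by (simp_all add: A_def B_def)
      show ?case
      proof (cases "?f z = 0")
        \<comment> \<open>Where the density vanishes the kernel identity says nothing, but both
          integrands are 0; this includes z = 0.\<close>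
        case True
        then show ?thesis
          using AB by (auto simp: indicator_def ennreal_mult'[of "A z * B z"] split: if_splits)
      next
        case False
        then have z: "0 \<le> z" by (auto simp: indicator_def split: if_splits)
        then have "(\<integral>\<^sup>+\<omega>. ?h \<omega> \<partial>K z) = ennreal (A z) * ennreal (B z)"
          using elim False by (simp add: zero_less_iff_neq_zero)
        then show ?thesis
          using z AB by (simp add: ennreal_mult'' ennreal_mult[of "A z * B z"] ennreal_mult[of "A z"] pos less_imp_le mult.commute)
      qed
    qed
  qed
  finally show ?thesis .
qed

section \<open>Coverage probability\<close>

text \<open>For infinite d, the case of infinite interference, the quotient is 0 and the product on
  the right is \<top>, so both sides fail; this uses t > 0. For negative x both truncated values are
  0.\<close>

lemma ennreal_less_divide_iff:
  assumes "0 < a" "0 < t" "0 < d"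
  shows "ennreal t < ennreal (a * x) / d \<longleftrightarrow> ennreal (t / a) * d < ennreal x"
proof (cases d)
  case (real y)
  then have y: "0 < y" using assms by simp
  show ?thesis
  proof (cases "0 \<le> x")
    case True
    then show ?thesis
      using assms y real
      by (simp add: divide_ennreal ennreal_less_iff ennreal_mult[symmetric] field_simps)
  next
    case False
    then have "ennreal (a * x) = 0" "ennreal x = 0"
      using assms by (auto simp: ennreal_eq_0_iff mult_le_0_iff)
    then show ?thesis by simp
  qed
next
  case top
  then show ?thesis using assms by (simp add: ennreal_mult_top)
qed

lemma (in prob_space) exponential_distributed_exceeds:
  assumes D: "distributed M lborel U (\<lambda>x. ennreal (exponential_density l x))" and l: "0 < l"
  shows "(\<integral>\<^sup>+\<omega>. of_bool (w < ennreal (U \<omega>)) \<partial>M) = ennreal (exp_neg (ennreal l * w))"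
proof (cases w)
  case (real y)
  have [measurable]: "U \<in> borel_measurable M" using D by (simp add: distributed_def)
  have "(\<integral>\<^sup>+\<omega>. of_bool (w < ennreal (U \<omega>)) \<partial>M) = (\<integral>\<^sup>+\<omega>. indicator {\<omega>\<in>space M. y < U \<omega>} \<omega> \<partial>M)"
    using real by (intro nn_integral_cong) (auto simp: ennreal_less_iff indicator_def)
  also have "\<dots> = ennreal (\<P>(\<omega> in M. y < U \<omega>))"
    by (simp add: emeasure_eq_measure)
  also have "\<dots> = ennreal (exp_neg (ennreal l * w))"
    using exponential_distributedD_gt[OF D real(1) l] real l
    by (simp add: ennreal_mult[symmetric] exp_neg_ennreal mult.commute)
  finally show ?thesis .
next
  case top
  then show ?thesis using l by (simp add: ennreal_mult_top)
qed

lemma SINR_measurable: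
  assumes [measurable]: "R_n X \<in> borel_measurable M" "beta X \<in> borel_measurable M"
      "ind_c1 X \<in> measurable M (count_space UNIV)" "sigma_t X \<in> borel_measurable M"
      "S_b A_rb X \<in> borel_measurable M" "I_IC1 p X \<in> borel_measurable M" "I_IC2 p X \<in> borel_measurable M"
      "I_L p X \<in> borel_measurable M" "I_N p X \<in> borel_measurable M"
  shows "SINR p R1 A_rb X \<in> borel_measurable M"
  unfolding SINR_def by measurable

text \<open>The angle pi is excluded because the signal coefficient \<open>a\<close> vanishes there
  and cannot be divided by. The measurability conclusions later yield measurability of the SINR on
  the original space.\<close>

lemma conditional_coverage:
  fixes Q :: "'w measure"
  assumes Q: "prob_space Q" and p: "valid_radar p" and R1: "0 < R1" and \<phi>: "0 < \<phi>"
    and r: "R1 \<le> r" and b: "0 \<le> b" "b < pi"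
    and A: "A_rb r b \<in> sets borel" "emeasure lborel (A_rb r b) = ennreal (cell_area p r b)"
    and AE: "AE \<omega> in Q. (R_n X \<omega>, beta X \<omega>) = (r, b)"
    and c1: "distr Q (count_space UNIV) (ind_c1 X) =
      measure_pmf (bernoulli_pmf (p_LOS p r * (real (n_freq p) - 1) / real (n_freq p)))"
    and c1m [measurable]: "ind_c1 X \<in> measurable Q (count_space UNIV)"
    and \<sigma>: "distributed Q lborel (sigma_t X) (\<lambda>x. ennreal (exponential_density (1 / sig_t p) x))"
    and intra: "intra_clutter_model p X Q" and inter: "inter_clutter_model p R1 A_rb X Q"
    and direct: "direct_interference_model p X Q"
    and ind: "prob_space.indep_sets Q
         ((!) [generated_events Q (count_space UNIV) (ind_c1 X),
               generated_events Q borel (sigma_t X),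
               generated_events Q borel (S_b A_rb X),
               generated_events Q (borel \<Otimes>\<^sub>M borel) (\<lambda>\<omega>. (I_IC1 p X \<omega>, I_IC2 p X \<omega>)),
               generated_events Q (borel \<Otimes>\<^sub>M borel) (\<lambda>\<omega>. (I_L p X \<omega>, I_N p X \<omega>))]) {..<5}"
      (is "prob_space.indep_sets Q ?F _")
  shows "sigma_t X \<in> borel_measurable Q" "S_b A_rb X \<in> borel_measurable Q"
    "I_IC1 p X \<in> borel_measurable Q" "I_IC2 p X \<in> borel_measurable Q"
    "I_L p X \<in> borel_measurable Q" "I_N p X \<in> borel_measurable Q"
    "(\<integral>\<^sup>+\<omega>. of_bool (ennreal \<phi> < SINR p R1 A_rb X \<omega>) \<partial>Q) =
        ennreal (p_LOS p r * (real (n_freq p) - 1) / real (n_freq p)) *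
        ennreal (C_b p \<phi> r b) *
        L_IC p R1 (\<phi> * R1 powr eta_L p / (sig_t p * cos (b / 2))) r b *
        ennreal (exp (- (\<phi> * (4 * pi) ^ 3 * R1 powr eta_L p * r powr eta_L p
                          * K_B p * temperature p * W_b p
                         / (P_s p * (G_m p)\<^sup>2 * (wavelength p)\<^sup>2 * cos (b / 2) * sig_t p)))) *
        L_D p (\<phi> * (4 * pi) ^ 3 * R1 powr eta_L p * r powr eta_L p
                / (P_s p * (G_m p)\<^sup>2 * (wavelength p)\<^sup>2 * cos (b / 2) * sig_t p))"
proof -
  interpret prob_space Q by fact
  have pos: "0 < sig_t p" "0 < K_B p" "0 < temperature p" "0 < W_b p" "0 < P_s p" "0 < G_m p" "0 < wavelength p"
    "0 < n_freq p" "0 < blockage p" "0 < light_speed p" "0 < theta_B p" "0 < sig_cl p"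
    using p by (auto simp: valid_radar_def)
  have cos: "0 < cos (b / 2)" using b by (intro cos_gt_zero_pi) auto
  have r0: "0 < r" using r R1 by simp
  have area: "0 \<le> cell_area p r b" using pos r0 by (simp add: cell_area_def)

  note meas = generated_events_measurableD[OF ind]
  show \<sigma>m [measurable]: "sigma_t X \<in> borel_measurable Q" using \<sigma> by (simp add: distributed_def)
  show Sm [measurable]: "S_b A_rb X \<in> borel_measurable Q" using meas[of 2 borel "S_b A_rb X"] by simp
  have "(\<lambda>\<omega>. (I_IC1 p X \<omega>, I_IC2 p X \<omega>)) \<in> measurable Q (borel \<Otimes>\<^sub>M borel)"
    by (rule meas[of 3]) (auto simp: space_pair_measure)
  from measurable_compose[OF this measurable_fst] measurable_compose[OF this measurable_snd]
  show I1m [measurable]: "I_IC1 p X \<in> borel_measurable Q" and I2m [measurable]: "I_IC2 p X \<in> borel_measurable Q"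
    by simp_all
  have "(\<lambda>\<omega>. (I_L p X \<omega>, I_N p X \<omega>)) \<in> measurable Q (borel \<Otimes>\<^sub>M borel)"
    by (rule meas[of 4]) (auto simp: space_pair_measure)
  from measurable_compose[OF this measurable_fst] measurable_compose[OF this measurable_snd]
  show ILm [measurable]: "I_L p X \<in> borel_measurable Q" and INm [measurable]: "I_N p X \<in> borel_measurable Q"
    by simp_all

  have S_lap: "(\<integral>\<^sup>+\<omega>. ennreal (exp_neg (ennreal c * S_b A_rb X \<omega>)) \<partial>Q) =
      ennreal (exp (- lam_cl p * cell_area p r b * (c * sig_cl p / (1 + c * sig_cl p))))" if "0 \<le> c" for c
    by (rule S_b_laplace[where r=r and b=b]) fact+

  \<comment> \<open>a multiplies the target cross-section in the numerator and also
    \<open>S_b\<close> in the denominator; k multiplies the inter-clutter sums and N is the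
    noise.\<close>
  define a where "a = kappa p * cos (b / 2) * R1 powr (- eta_L p) * r powr (- eta_L p)"
  define k where "k = kappa p * r powr (- eta_L p)"
  define N where "N = K_B p * temperature p * W_b p"
  have \<kappa>: "0 < kappa p" using pos by (simp add: kappa_def)
  have a: "0 < a" using \<kappa> cos R1 r0 by (simp add: a_def)
  have k: "0 < k" using \<kappa> r0 by (simp add: k_def)
  have N: "0 < N" using pos by (simp add: N_def)
  \<comment> \<open>The event is that the cross-section exceeds \<phi> / a times the denominator;
    its exponential law has rate 1 / \<open>sig_t\<close>, and t is the product of the two
    factors.\<close>
  define t where "t = \<phi> / (a * sig_t p)"
  have t: "0 < t" using \<phi> a pos by (simp add: t_def)
  have t_eq: "t = \<phi> * (4 * pi) ^ 3 * R1 powr eta_L p * r powr eta_L p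
                / (P_s p * (G_m p)\<^sup>2 * (wavelength p)\<^sup>2 * cos (b / 2) * sig_t p)"
    using R1 r0 by (simp add: t_def a_def kappa_def powr_minus field_simps)
  \<comment> \<open>The coefficient a cancels, so distance and angle enter \<open>C_b\<close> only
    through the cell area.\<close>
  have ta: "t * a = \<phi> / sig_t p" using a by (simp add: t_def)
  \<comment> \<open>In k / a the constant \<open>kappa\<close> and the power of r cancel, which
    explains the argument of \<open>L_IC\<close>.\<close>
  have tk: "t * k = \<phi> * R1 powr eta_L p / (sig_t p * cos (b / 2))"
    using R1 r0 \<kappa> by (simp add: t_def a_def k_def powr_minus field_simps)

  define den where "den S I1 I2 J1 J2 = ennreal a * S + ennreal k * (I1 + I2) + ennreal N + J1 + J2"
    for S I1 I2 J1 J2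
  \<comment> \<open>The noise is positive, so the quotient never has denominator 0.\<close>
  have den_pos: "0 < den S I1 I2 J1 J2" for S I1 I2 J1 J2
  proof -
    have "ennreal N \<le> den S I1 I2 J1 J2"
      unfolding den_def by (metis add.commute add.assoc le_iff_add)
    then show ?thesis using N by (meson ennreal_less_zero_iff less_le_trans)
  qed
  have den_exp: "exp_neg (ennreal t * den S I1 I2 J1 J2) =
      exp_neg (ennreal (t * a) * S) * exp_neg (ennreal (t * k) * (I1 + I2)) * exp (- (t * N)) * exp_neg (ennreal t * (J1 + J2))"
    for S I1 I2 J1 J2
    using a k N t unfolding den_def
    by (simp add: distrib_left exp_neg_add exp_neg_ennreal ennreal_mult[symmetric] mult.assoc[symmetric])
  have [measurable]: "(\<lambda>z. den (s z) (i1 z) (i2 z) (j1 z) (j2 z)) \<in> borel_measurable M'"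
    if [measurable]: "s \<in> borel_measurable M'" "i1 \<in> borel_measurable M'" "i2 \<in> borel_measurable M'"
      "j1 \<in> borel_measurable M'" "j2 \<in> borel_measurable M'" for s i1 i2 j1 j2 and M' :: "'z measure"
    unfolding den_def by measurable
  let ?den = "\<lambda>\<omega>. den (S_b A_rb X \<omega>) (I_IC1 p X \<omega>) (I_IC2 p X \<omega>) (I_L p X \<omega>) (I_N p X \<omega>)"

  define B where "B i = sigma (space Q) (?F i)" for i :: nat
  have B: "indep_vars B (\<lambda>_ \<omega>. \<omega>) {..<5}"
    unfolding B_def
    by (rule indep_sets_imp_indep_vars_identity[OF ind])
      (auto simp: numeral_eq_Suc less_Suc_eq generated_events_Int_stable)
  have [measurable]: "ind_c1 X \<in> measurable (B 0) (count_space UNIV)" "sigma_t X \<in> borel_measurable (B 1)"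
    "sigma_t X \<in> borel_measurable (B (Suc 0))" "S_b A_rb X \<in> borel_measurable (B 2)"
    unfolding B_def by (simp_all add: measurable_generated_events)
  have B3: "(\<lambda>\<omega>. (I_IC1 p X \<omega>, I_IC2 p X \<omega>)) \<in> measurable (B 3) (borel \<Otimes>\<^sub>M borel)"
    and B4: "(\<lambda>\<omega>. (I_L p X \<omega>, I_N p X \<omega>)) \<in> measurable (B 4) (borel \<Otimes>\<^sub>M borel)"
    unfolding B_def by (simp_all add: measurable_generated_events space_pair_measure)
  have [measurable]: "I_IC1 p X \<in> borel_measurable (B 3)" "I_IC2 p X \<in> borel_measurable (B 3)"
    using measurable_compose[OF B3 measurable_fst] measurable_compose[OF B3 measurable_snd] by simp_all
  have [measurable]: "I_L p X \<in> borel_measurable (B 4)" "I_N p X \<in> borel_measurable (B 4)"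
    using measurable_compose[OF B4 measurable_fst] measurable_compose[OF B4 measurable_snd] by simp_all

  \<comment> \<open>v supplies the cross-section alone and u everything else, so that the inner
    integral is an exponential tail at a constant level.\<close>
  let ?G = "\<lambda>(u :: nat \<Rightarrow> 'w, v :: nat \<Rightarrow> 'w). of_bool (ind_c1 X (u 0)) *
    (of_bool (ennreal (\<phi> / a) * den (S_b A_rb X (u 2)) (I_IC1 p X (u 3)) (I_IC2 p X (u 3)) (I_L p X (u 4)) (I_N p X (u 4))
       < ennreal (sigma_t X (v 1))) :: ennreal)"
  have "(\<integral>\<^sup>+\<omega>. of_bool (ennreal \<phi> < SINR p R1 A_rb X \<omega>) \<partial>Q) =
      (\<integral>\<^sup>+\<omega>. of_bool (ind_c1 X \<omega>) * of_bool (ennreal (\<phi> / a) * ?den \<omega> < ennreal (sigma_t X \<omega>)) \<partial>Q)"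
  proof (rule nn_integral_cong_AE)
    show "AE \<omega> in Q. (of_bool (ennreal \<phi> < SINR p R1 A_rb X \<omega>) :: ennreal) =
        of_bool (ind_c1 X \<omega>) * of_bool (ennreal (\<phi> / a) * ?den \<omega> < ennreal (sigma_t X \<omega>))"
      using AE
    proof eventually_elim
      case (elim \<omega>)
      then have "R_n X \<omega> = r" "beta X \<omega> = b" by simp_all
      then have "SINR p R1 A_rb X \<omega> = (if ind_c1 X \<omega> then ennreal (a * sigma_t X \<omega>) / ?den \<omega> else 0)"
        by (simp add: SINR_def den_def a_def k_def N_def mult_ac)
      then show ?case
        using ennreal_less_divide_iff[OF a \<phi> den_pos] by simp
    qed
  qed
  also have "\<dots> = (\<integral>\<^sup>+\<omega>. ?G (restrict (\<lambda>_. \<omega>) {0, 2, 3, 4}, restrict (\<lambda>_. \<omega>) {1}) \<partial>Q)"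
    by simp
  also have "\<dots> = (\<integral>\<^sup>+\<omega>. \<integral>\<^sup>+\<omega>'. ?G (restrict (\<lambda>_. \<omega>) {0, 2, 3, 4}, restrict (\<lambda>_. \<omega>') {1}) \<partial>Q \<partial>Q)"
    by (rule indep_vars_nn_integral_split[OF B, where J="{0, 2, 3, 4}" and K="{1}" and G="?G"]) auto
  also have "\<dots> = (\<integral>\<^sup>+\<omega>. of_bool (ind_c1 X \<omega>) * ennreal (exp_neg (ennreal t * ?den \<omega>)) \<partial>Q)"
  proof (intro nn_integral_cong)
    fix \<omega>
    have "t = 1 / sig_t p * (\<phi> / a)" by (simp add: t_def)
    then have "ennreal t = ennreal (1 / sig_t p) * ennreal (\<phi> / a)"
      using pos \<phi> a by (simp only:) (intro ennreal_mult; simp)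
    then have "ennreal (1 / sig_t p) * (ennreal (\<phi> / a) * d) = ennreal t * d" for d
      by (simp only: mult.assoc)
    then show "(\<integral>\<^sup>+\<omega>'. ?G (restrict (\<lambda>_. \<omega>) {0, 2, 3, 4}, restrict (\<lambda>_. \<omega>') {1}) \<partial>Q) =
        of_bool (ind_c1 X \<omega>) * ennreal (exp_neg (ennreal t * ?den \<omega>))"
      using pos by (simp add: nn_integral_cmult exponential_distributed_exceeds[OF \<sigma>])
  qed
  finally have cov: "(\<integral>\<^sup>+\<omega>. of_bool (ennreal \<phi> < SINR p R1 A_rb X \<omega>) \<partial>Q) =
      (\<integral>\<^sup>+\<omega>. of_bool (ind_c1 X \<omega>) * ennreal (exp_neg (ennreal t * ?den \<omega>)) \<partial>Q)" .
  \<comment> \<open>The cross-section is already integrated out; the constant 1 takes its place so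
    that the index set of the independence hypothesis is kept.\<close>
  define Y :: "nat \<Rightarrow> 'w \<Rightarrow> ennreal" where "Y i \<omega> =
     [of_bool (ind_c1 X \<omega>), 1, ennreal (exp_neg (ennreal (t * a) * S_b A_rb X \<omega>)),
      ennreal (exp_neg (ennreal (t * k) * (I_IC1 p X \<omega> + I_IC2 p X \<omega>))),
      ennreal (exp_neg (ennreal t * (I_L p X \<omega> + I_N p X \<omega>)))] ! i" for i \<omega>
  have Y: "Y 0 = (\<lambda>\<omega>. of_bool (ind_c1 X \<omega>))" "Y 1 = (\<lambda>\<omega>. 1)"
    "Y 2 = (\<lambda>\<omega>. ennreal (exp_neg (ennreal (t * a) * S_b A_rb X \<omega>)))"
    "Y 3 = (\<lambda>\<omega>. ennreal (exp_neg (ennreal (t * k) * (I_IC1 p X \<omega> + I_IC2 p X \<omega>))))"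
    "Y 4 = (\<lambda>\<omega>. ennreal (exp_neg (ennreal t * (I_L p X \<omega> + I_N p X \<omega>))))"
    by (auto simp: Y_def)
  have prod5: "(\<Prod>i<5. f i) = f 0 * f 1 * f 2 * f 3 * f 4" for f :: "nat \<Rightarrow> ennreal"
    by (simp add: eval_nat_numeral mult.assoc)
  have "indep_vars (\<lambda>_. borel) Y {..<5}"
  proof (rule indep_vars_compose2[OF B, of Y "\<lambda>_. borel"])
    fix i :: nat assume "i \<in> {..<5}"
    then consider "i = 0" | "i = 1" | "i = 2" | "i = 3" | "i = 4" by fastforce
    then show "Y i \<in> borel_measurable (B i)"
      by cases (simp_all only: Y, measurable)
  qed
  then have prod_Y: "(\<integral>\<^sup>+\<omega>. (\<Prod>i<5. Y i \<omega>) \<partial>Q) = (\<Prod>i<5. \<integral>\<^sup>+\<omega>. Y i \<omega> \<partial>Q)"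
    by (intro indep_vars_nn_integral) auto
  have [measurable]: "Y 0 \<in> borel_measurable Q" "Y 2 \<in> borel_measurable Q" "Y 3 \<in> borel_measurable Q" "Y 4 \<in> borel_measurable Q"
    unfolding Y by measurable
  have "(\<integral>\<^sup>+\<omega>. of_bool (ind_c1 X \<omega>) * ennreal (exp_neg (ennreal t * ?den \<omega>)) \<partial>Q) =
      (\<integral>\<^sup>+\<omega>. ennreal (exp (- (t * N))) * (\<Prod>i<5. Y i \<omega>) \<partial>Q)"
    unfolding prod5 Y by (intro nn_integral_cong) (simp add: den_exp ennreal_mult mult_ac)
  also have "\<dots> = ennreal (exp (- (t * N))) * (\<integral>\<^sup>+\<omega>. (\<Prod>i<5. Y i \<omega>) \<partial>Q)"
    unfolding prod5 Y by (intro nn_integral_cmult) measurable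
  also have "\<dots> = ennreal (exp (- (t * N))) * ((\<integral>\<^sup>+\<omega>. Y 0 \<omega> \<partial>Q) * (\<integral>\<^sup>+\<omega>. Y 1 \<omega> \<partial>Q) * (\<integral>\<^sup>+\<omega>. Y 2 \<omega> \<partial>Q) *
      (\<integral>\<^sup>+\<omega>. Y 3 \<omega> \<partial>Q) * (\<integral>\<^sup>+\<omega>. Y 4 \<omega> \<partial>Q))"
    by (simp only: prod_Y) (simp only: prod5)
  also have "(\<integral>\<^sup>+\<omega>. Y 0 \<omega> \<partial>Q) = ennreal (p_LOS p r * (real (n_freq p) - 1) / real (n_freq p))"
  proof -
    let ?q = "p_LOS p r * (real (n_freq p) - 1) / real (n_freq p)"
    have l: "0 \<le> p_LOS p r" "p_LOS p r \<le> 1" using pos r0 by (simp_all add: p_LOS_def)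
    have "p_LOS p r * (real (n_freq p) - 1) \<le> 1 * real (n_freq p)"
      using l pos by (intro mult_mono) auto
    \<comment> \<open>\<open>bernoulli_pmf\<close> has the stated success probability only for a
      parameter in [0, 1].\<close>
    then have q: "0 \<le> ?q" "?q \<le> 1" using l pos by (simp_all add: divide_le_eq_1)
    have "(\<integral>\<^sup>+\<omega>. Y 0 \<omega> \<partial>Q) = (\<integral>\<^sup>+c. of_bool c \<partial>distr Q (count_space UNIV) (ind_c1 X))"
      unfolding Y by (rule nn_integral_distr[symmetric]) auto
    also have "\<dots> = ennreal ?q"
      unfolding c1 using q by (subst nn_integral_bernoulli_pmf) auto
    finally show ?thesis .
  qed
  also have "(\<integral>\<^sup>+\<omega>. Y 1 \<omega> \<partial>Q) = 1"
    unfolding Y by (simp add: emeasure_space_1)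
  also have "(\<integral>\<^sup>+\<omega>. Y 2 \<omega> \<partial>Q) = ennreal (C_b p \<phi> r b)"
  proof -
    have "0 < 1 + t * a * sig_cl p" "0 < sig_t p + \<phi> * sig_cl p"
      using t a pos \<phi> by (simp_all add: add_pos_pos)
    then have "t * a * sig_cl p / (1 + t * a * sig_cl p) = \<phi> * sig_cl p / (sig_t p + \<phi> * sig_cl p)"
      using pos by (simp add: ta frac_eq_eq) (simp add: field_simps)
    then show ?thesis
      unfolding Y C_b_def using t a
      by (subst S_lap) auto
  qed
  also have "(\<integral>\<^sup>+\<omega>. Y 3 \<omega> \<partial>Q) = L_IC p R1 (\<phi> * R1 powr eta_L p / (sig_t p * cos (b / 2))) r b"
    unfolding Y tk[symmetric] using t k
    by (intro L_IC_laplace[OF Q p R1 inter Sm S_lap area I1m I2m]) auto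
  also have "(\<integral>\<^sup>+\<omega>. Y 4 \<omega> \<partial>Q) = L_D p t"
    unfolding Y using t by (intro L_D_laplace[OF Q p direct ILm INm]) auto
  also have "t * N = \<phi> * (4 * pi) ^ 3 * R1 powr eta_L p * r powr eta_L p * K_B p * temperature p * W_b p
                         / (P_s p * (G_m p)\<^sup>2 * (wavelength p)\<^sup>2 * cos (b / 2) * sig_t p)"
    by (simp add: t_eq N_def)
  finally show "(\<integral>\<^sup>+\<omega>. of_bool (ennreal \<phi> < SINR p R1 A_rb X \<omega>) \<partial>Q) =
        ennreal (p_LOS p r * (real (n_freq p) - 1) / real (n_freq p)) *
        ennreal (C_b p \<phi> r b) *
        L_IC p R1 (\<phi> * R1 powr eta_L p / (sig_t p * cos (b / 2))) r b *
        ennreal (exp (- (\<phi> * (4 * pi) ^ 3 * R1 powr eta_L p * r powr eta_L p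
                          * K_B p * temperature p * W_b p
                         / (P_s p * (G_m p)\<^sup>2 * (wavelength p)\<^sup>2 * cos (b / 2) * sig_t p)))) *
        L_D p (\<phi> * (4 * pi) ^ 3 * R1 powr eta_L p * r powr eta_L p
                / (P_s p * (G_m p)\<^sup>2 * (wavelength p)\<^sup>2 * cos (b / 2) * sig_t p))"
    unfolding cov t_eq by (simp only: mult_1_left mult_1_right mult_ac)
qed

theorem theorem2:
  fixes p :: radar and n :: nat and R1 \<phi> :: real
    and A_rb :: "real \<Rightarrow> real \<Rightarrow> (real^2) set"
    and \<P> :: "'w measure" and X :: "'w network"
  assumes "valid_radar p" and "n \<ge> 2" and "R1 > 0" and "\<phi> > 0"
    and "bistatic_model p n R1 A_rb \<P> X"
  shows "ennreal (coverage_probability p R1 A_rb \<P> X \<phi>) =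
    (\<integral>\<^sup>+r\<in>{R1..}. (\<integral>\<^sup>+b\<in>{0..pi}.
        ennreal (p_LOS p r * (real (n_freq p) - 1) / real (n_freq p)) *
        ennreal (C_b p \<phi> r b) *
        L_IC p R1 (\<phi> * R1 powr eta_L p / (sig_t p * cos (b / 2))) r b *
        ennreal (exp (- (\<phi> * (4 * pi) ^ 3 * R1 powr eta_L p * r powr eta_L p
                          * K_B p * temperature p * W_b p
                         / (P_s p * (G_m p)\<^sup>2 * (wavelength p)\<^sup>2 * cos (b / 2) * sig_t p)))) *
        L_D p (\<phi> * (4 * pi) ^ 3 * R1 powr eta_L p * r powr eta_L p
                / (P_s p * (G_m p)\<^sup>2 * (wavelength p)\<^sup>2 * cos (b / 2) * sig_t p)) *
        ennreal (2 * (lam_BS p * pi) ^ (n - 1) / fact (n - 2) * (r\<^sup>2 - R1\<^sup>2) ^ (n - 2) * r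
                 * exp (- lam_BS p * pi * (r\<^sup>2 - R1\<^sup>2)) * (1 / pi))
      \<partial>lborel) \<partial>lborel)"
proof -
  define C where "C r b = ennreal (p_LOS p r * (real (n_freq p) - 1) / real (n_freq p)) *
        ennreal (C_b p \<phi> r b) *
        L_IC p R1 (\<phi> * R1 powr eta_L p / (sig_t p * cos (b / 2))) r b *
        ennreal (exp (- (\<phi> * (4 * pi) ^ 3 * R1 powr eta_L p * r powr eta_L p
                          * K_B p * temperature p * W_b p
                         / (P_s p * (G_m p)\<^sup>2 * (wavelength p)\<^sup>2 * cos (b / 2) * sig_t p)))) *
        L_D p (\<phi> * (4 * pi) ^ 3 * R1 powr eta_L p * r powr eta_L p
                / (P_s p * (G_m p)\<^sup>2 * (wavelength p)\<^sup>2 * cos (b / 2) * sig_t p))" for r b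
  let ?f = "\<lambda>r. ennreal (density_R_n p n R1 r) * indicator {R1..} r"
  let ?g = "\<lambda>b. ennreal (indicator {0..pi} b / pi)"
  let ?Z = "\<lambda>\<omega>. (R_n X \<omega>, beta X \<omega>)"
  let ?h = "\<lambda>\<omega>. of_bool (ennreal \<phi> < SINR p R1 A_rb X \<omega>) :: ennreal"
  have P: "prob_space \<P>" and cells: "resolution_cells p R1 A_rb"
    and dR: "distributed \<P> lborel (R_n X) ?f" and d\<beta>: "distributed \<P> lborel (beta X) ?g"
    and ind: "prob_space.indep_var \<P> borel (R_n X) borel (beta X)"
    using assms(5) by (auto simp: bistatic_model_def uniform_angle_def)
  interpret prob_space \<P> by fact
  let ?Q = "\<lambda>r Q. distr Q (count_space UNIV) (ind_c1 X)
         = measure_pmf (bernoulli_pmf (p_LOS p r * (real (n_freq p) - 1) / real (n_freq p))) \<and>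
       ind_c1 X \<in> measurable Q (count_space UNIV) \<and>
       distributed Q lborel (sigma_t X) (\<lambda>x. ennreal (exponential_density (1 / sig_t p) x)) \<and>
       intra_clutter_model p X Q \<and>
       inter_clutter_model p R1 A_rb X Q \<and>
       direct_interference_model p X Q \<and>
       prob_space.indep_sets Q
         ((!) [generated_events Q (count_space UNIV) (ind_c1 X),
               generated_events Q borel (sigma_t X),
               generated_events Q borel (S_b A_rb X),
               generated_events Q (borel \<Otimes>\<^sub>M borel) (\<lambda>\<omega>. (I_IC1 p X \<omega>, I_IC2 p X \<omega>)),
               generated_events Q (borel \<Otimes>\<^sub>M borel) (\<lambda>\<omega>. (I_L p X \<omega>, I_N p X \<omega>))]) {..<5}"
  obtain K where K: "regular_conditional_probability \<P> borel ?Z K"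
    and AEK: "AE z in distr \<P> borel ?Z. ?Q (fst z) (K z)"
    using assms(5) unfolding bistatic_model_def conditionally_on_def split_beta' by blast
  note kernel = regular_conditional_probability_kernel[OF K, simplified]
  have [measurable]: "R_n X \<in> borel_measurable \<P>" "beta X \<in> borel_measurable \<P>"
    using dR d\<beta> by (auto simp: distributed_def)
  then have Z [measurable]: "?Z \<in> borel_measurable \<P>" by simp
  interpret Z: prob_space "distr \<P> borel ?Z" by (rule prob_space_distr[OF Z])

  \<comment> \<open>Sections of the jointly measurable family of cells are Borel.\<close>
  have cell: "A_rb r b \<in> sets borel" for r b
  proof -
    have "(\<lambda>x :: real^2. (r, b, x)) \<in> borel_measurable borel" by simp
    then have "(\<lambda>x :: real^2. (r, b, x)) -` {(r, b, x). x \<in> A_rb r b} \<in> sets borel"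
      using cells by (intro measurable_sets_borel) (auto simp: resolution_cells_def)
    then show ?thesis by (simp add: vimage_def)
  qed
  have "AE y in density lborel ?g. y \<noteq> pi"
    using AE_lborel_singleton[of pi] by (subst AE_density) auto
  then have "AE y in distr \<P> lborel (beta X). y \<noteq> pi"
    unfolding distributed_distr_eq_density[OF d\<beta>] .
  then have "AE \<omega> in \<P>. beta X \<omega> \<noteq> pi"
    by (subst (asm) AE_distr_iff) auto
  then have AE_pi: "AE z in distr \<P> borel ?Z. snd z \<noteq> pi"
    by (subst AE_distr_iff) (auto simp: borel_prod[symmetric])
  have R_n_ge: "R1 \<le> r" if "?f r \<noteq> 0" for r
    using that by (auto simp: indicator_def split: if_splits)
  have beta_range: "0 \<le> y \<and> y \<le> pi" if "?g y \<noteq> 0" for y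
    using that by (auto simp: indicator_def split: if_splits)

  \<comment> \<open>Measurability of the SINR does not involve z; it is carried along because it is
    obtained from the independence under the kernel at a good z.\<close>
  have good: "AE z in distr \<P> borel ?Z. R1 \<le> fst z \<longrightarrow> 0 \<le> snd z \<and> snd z \<le> pi \<longrightarrow>
      (\<integral>\<^sup>+\<omega>. ?h \<omega> \<partial>K z) = C (fst z) (snd z) \<and> SINR p R1 A_rb X \<in> borel_measurable \<P>"
    using AEK regular_conditional_probability_AE_eq[OF P K] AE_pi
  proof eventually_elim
    case (elim z)
    show ?case
    proof (intro impI)
      assume z: "R1 \<le> fst z" "0 \<le> snd z \<and> snd z \<le> pi"
      then have z': "0 \<le> snd z" "snd z < pi" using elim(3) by auto
      have area: "emeasure lborel (A_rb (fst z) (snd z)) = ennreal (cell_area p (fst z) (snd z))"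
        using cells z z' by (simp add: resolution_cells_def)
      have Z_eq: "AE \<omega> in K z. ?Z \<omega> = (fst z, snd z)" using elim(2) by simp
      note E = elim(1)
      note cov = conditional_coverage[OF kernel(1) assms(1,3,4) z(1) z' cell area Z_eq E[THEN conjunct1]
          E[THEN conjunct2, THEN conjunct1] E[THEN conjunct2, THEN conjunct2, THEN conjunct1]
          E[THEN conjunct2, THEN conjunct2, THEN conjunct2, THEN conjunct1]
          E[THEN conjunct2, THEN conjunct2, THEN conjunct2, THEN conjunct2, THEN conjunct1]
          E[THEN conjunct2, THEN conjunct2, THEN conjunct2, THEN conjunct2, THEN conjunct2, THEN conjunct1]
          E[THEN conjunct2, THEN conjunct2, THEN conjunct2, THEN conjunct2, THEN conjunct2, THEN conjunct2]]
      \<comment> \<open>Kernels have the \<sigma>-algebra of the original measure, so measurability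
        transfers back.\<close>
      have sets: "measurable (K z) N = measurable \<P> N" for N :: "'n measure"
        by (rule measurable_cong_sets) (simp_all add: kernel(2))
      have "SINR p R1 A_rb X \<in> borel_measurable \<P>"
        using cov(1-6) E[THEN conjunct2, THEN conjunct1] by (intro SINR_measurable) (simp_all add: sets)
      then show "(\<integral>\<^sup>+\<omega>. ?h \<omega> \<partial>K z) = C (fst z) (snd z) \<and> SINR p R1 A_rb X \<in> borel_measurable \<P>"
        using cov(7) by (simp add: C_def)
    qed
  qed
  have "AE z in distr \<P> borel ?Z. R1 \<le> fst z \<and> 0 \<le> snd z \<and> snd z \<le> pi"
  proof -
    have "AE x in density lborel ?f. R1 \<le> x" "AE y in density lborel ?g. 0 \<le> y \<and> y \<le> pi"
      using R_n_ge beta_range distributed_borel_measurable[OF dR] distributed_borel_measurable[OF d\<beta>]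
      by (simp_all only: AE_density zero_less_iff_neq_zero) (intro AE_I2 impI; blast)+
    then have "AE x in distr \<P> lborel (R_n X). R1 \<le> x" "AE y in distr \<P> lborel (beta X). 0 \<le> y \<and> y \<le> pi"
      unfolding distributed_distr_eq_density[OF dR] distributed_distr_eq_density[OF d\<beta>] .
    then have "AE \<omega> in \<P>. R1 \<le> R_n X \<omega>" "AE \<omega> in \<P>. 0 \<le> beta X \<omega> \<and> beta X \<omega> \<le> pi"
      by (auto simp: AE_distr_iff)
    then show ?thesis
      by (subst AE_distr_iff) (auto simp: borel_prod[symmetric])
  qed
  with good have "AE z in distr \<P> borel ?Z. SINR p R1 A_rb X \<in> borel_measurable \<P>"
    by eventually_elim auto
  \<comment> \<open>An almost sure statement on a probability space holds at some point, and one
    good z is enough.\<close>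
  then have SINR [measurable]: "SINR p R1 A_rb X \<in> borel_measurable \<P>"
    using eventually_happens' Z.ae_filter_bot by blast
  have h: "?h \<in> borel_measurable \<P>" by measurable
  have AE: "AE z in distr \<P> borel ?Z. ?f (fst z) \<noteq> 0 \<longrightarrow> ?g (snd z) \<noteq> 0 \<longrightarrow>
      (\<integral>\<^sup>+\<omega>. ?h \<omega> \<partial>K z) = (\<lambda>z. C (fst z) (snd z)) z"
    using good by eventually_elim (use R_n_ge beta_range in blast)
  have "ennreal (coverage_probability p R1 A_rb \<P> X \<phi>) = emeasure \<P> {\<omega> \<in> space \<P>. SINR p R1 A_rb X \<omega> > ennreal \<phi>}"
    by (simp add: coverage_probability_def emeasure_eq_measure)
  also have "\<dots> = (\<integral>\<^sup>+\<omega>. indicator {\<omega> \<in> space \<P>. SINR p R1 A_rb X \<omega> > ennreal \<phi>} \<omega> \<partial>\<P>)"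
    by (rule nn_integral_indicator[symmetric]) measurable
  also have "\<dots> = (\<integral>\<^sup>+\<omega>. ?h \<omega> \<partial>\<P>)"
    by (intro nn_integral_cong) (simp add: indicator_def)
  also have "\<dots> = (\<integral>\<^sup>+z. (\<integral>\<^sup>+\<omega>. ?h \<omega> \<partial>K z) \<partial>distr \<P> borel ?Z)"
    by (rule nn_integral_regular_conditional_probability[OF P K h])
  also have "\<dots> = (\<integral>\<^sup>+r. \<integral>\<^sup>+b. ?f r * (?g b * (\<lambda>z. C (fst z) (snd z)) (r, b)) \<partial>lborel \<partial>lborel)"
    by (rule nn_integral_distr_indep_densities[OF P dR d\<beta> ind
        nn_integral_regular_conditional_probability(2)[OF P K h] AE])
  also have "\<dots> = (\<integral>\<^sup>+r\<in>{R1..}. (\<integral>\<^sup>+b\<in>{0..pi}. C r b * ennreal (density_R_n p n R1 r * (1 / pi)) \<partial>lborel) \<partial>lborel)"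
  proof (intro nn_integral_cong)
    fix r
    show "(\<integral>\<^sup>+b. ?f r * (?g b * (\<lambda>z. C (fst z) (snd z)) (r, b)) \<partial>lborel) =
        (\<integral>\<^sup>+b\<in>{0..pi}. C r b * ennreal (density_R_n p n R1 r * (1 / pi)) \<partial>lborel) * indicator {R1..} r"
    proof (cases "R1 \<le> r")
      case True
      have "ennreal (density_R_n p n R1 r * (1 / pi)) = ennreal (density_R_n p n R1 r) * ennreal (1 / pi)"
        by (rule ennreal_mult'') simp
      then show ?thesis
        using True by (auto intro!: nn_integral_cong simp: indicator_def mult_ac)
    qed simp
  qed
  finally show ?thesis
    by (simp only: C_def density_R_n_def)
qed

end
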